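(* Let $X$ be an infinite dimensional complex Banach space and suppose that $T\in B(X)$ has the single valued extension property (SVEP). Then the following statements are equivalent: (i) Weyl's theorem holds for $T$, i.e. $\sigma(T)\setminus\omega(T)=\pi_{00}(T)$; (ii) $R(T-\lambda)$ is closed for all $\lambda\in\pi_{00}(T)$; (iii) $\mathcal{X}_T(\{\lambda\})$ is finite dimensional for every $\lambda\in\pi_{00}(T)$; (iv) the function $\zeta\mapsto\gamma_T(\zeta)$ is discontinuous on $\pi_{00}(T)$, i.e. it is discontinuous at each $\lambda\in\pi_{00}(T)$, where $\gamma_T$ denotes the reduced minimum modulus $$\gamma_T(\zeta):=\inf\left\{\frac{\|(T-\zeta)x\|}{\operatorname{dist}(x,N(T-\zeta))}:x\in X\setminus N(T-\zeta)\right\}.$$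
   Context: $B(X)$ is the algebra of bounded linear operators on $X$; $N(T)$ and $R(T)$ denote the null space and range of $T$; $\alpha(T):=\dim N(T)$, $\beta(T):=\dim X/R(T)$; $\sigma(T)$ is the spectrum of $T$. $T$ is Fredholm if $R(T)$ is closed and $\alpha(T),\beta(T)<\infty$; its index is $i(T)=\alpha(T)-\beta(T)$; $T$ is Weyl if it is Fredholm of index zero. The Weyl spectrum is $\omega(T):=\{\lambda\in\mathbb{C}:T-\lambda\text{ is not Weyl}\}$. $\pi_{00}(T):=\{\lambda\in\operatorname{iso}\sigma(T):0<\alpha(T-\lambda)<\infty\}$, where $\operatorname{iso}K$ is the set of isolated points of $K\subseteq\mathbb{C}$. $T$ has the single valued extension property (SVEP) if for every open set $U\subseteq\mathbb{C}$ the only analytic function $f:U\to X$ with $(T-\lambda)f(\lambda)=0$ for all $\lambda\in U$ is the zero function. For closed $G\subseteq\mathbb{C}$, the glocal spectral subspace $\mathcal{X}_T(G)$ is the set of $x\in X$ for which there exists an analytic function $f:\mathbb{C}\setminus G\to X$ with $(T-\lambda)f(\lambda)=x$ for all $\lambda\in\mathbb{C}\setminus G$. *)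

theory Defs
  imports "HOL-Analysis.Analysis"
begin

text \<open>HOL-Analysis only has real normed spaces. A complex Banach space is a real one with a
  complex scalar multiplication that extends \<^const>\<open>scaleR\<close> and is compatible with the norm.\<close>

class complex_normed_vector = real_normed_vector +
  fixes scaleC :: "complex \<Rightarrow> 'a \<Rightarrow> 'a"  (infixr \<open>*\<^sub>C\<close> 75)
  assumes scaleC_add_right: "a *\<^sub>C (x + y) = a *\<^sub>C x + a *\<^sub>C y"
    and scaleC_add_left: "(a + b) *\<^sub>C x = a *\<^sub>C x + b *\<^sub>C x"
    and scaleC_scaleC: "a *\<^sub>C (b *\<^sub>C x) = (a * b) *\<^sub>C x"
    and scaleC_of_real: "complex_of_real r *\<^sub>C x = r *\<^sub>R x"
    and norm_scaleC: "norm (a *\<^sub>C x) = cmod a * norm x"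

class complex_banach = complex_normed_vector + complete_space

instantiation complex :: complex_banach
begin

definition scaleC_complex :: "complex \<Rightarrow> complex \<Rightarrow> complex" where
  "scaleC_complex a x = a * x"

instance
  by standard (simp_all add: scaleC_complex_def algebra_simps norm_mult scaleR_conv_of_real)

end

global_interpretation complex_vector:
  vector_space "scaleC :: complex \<Rightarrow> 'a \<Rightarrow> 'a::complex_normed_vector"
proof
  fix x :: 'a
  show "1 *\<^sub>C x = x"
    using scaleC_of_real[of 1 x] by simp
qed (simp_all add: scaleC_add_right scaleC_add_left scaleC_scaleC)


text \<open>All dimensions are over the complex numbers. The library's \<open>dim\<close> is a natural
  number that carries no information for infinite dimensional subspaces.\<close>

definition fin_dim :: "'a::complex_normed_vector set \<Rightarrow> bool" where
  "fin_dim V \<longleftrightarrow> (\<exists>B. finite B \<and> complex_vector.span B = V)"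

definition cdim :: "'a::complex_normed_vector set \<Rightarrow> enat" where
  "cdim V = (if fin_dim V then enat (complex_vector.dim V) else \<infinity>)"

text \<open>\<open>quotient_basis R B\<close>: the cosets \<open>b + R\<close>, for \<open>b\<close> in the finite set \<open>B\<close>, are pairwise
  distinct and form a basis of the quotient of the whole space by the subspace \<open>R\<close>
  (a linear combination of cosets is zero in the quotient iff the same combination of
  representatives lies in \<open>R\<close>).\<close>

definition quotient_basis ::
    "'a::complex_normed_vector set \<Rightarrow> 'a set \<Rightarrow> bool" where
  "quotient_basis R B \<longleftrightarrow>
     finite B \<and>
     (\<forall>c. (\<Sum>b\<in>B. c b *\<^sub>C b) \<in> R \<longrightarrow> (\<forall>b\<in>B. c b = 0)) \<and>
     (\<forall>x. \<exists>c. x - (\<Sum>b\<in>B. c b *\<^sub>C b) \<in> R)"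

definition quotient_dim :: "'a::complex_normed_vector set \<Rightarrow> enat" where
  "quotient_dim R =
     (if \<exists>B. quotient_basis R B then enat (card (SOME B. quotient_basis R B)) else \<infinity>)"


definition bounded_clinear ::
    "('a::complex_normed_vector \<Rightarrow> 'b::complex_normed_vector) \<Rightarrow> bool" where
  "bounded_clinear T \<longleftrightarrow> bounded_linear T \<and> (\<forall>c x. T (c *\<^sub>C x) = c *\<^sub>C T x)"

definition shift :: "('a::complex_normed_vector \<Rightarrow> 'a) \<Rightarrow> complex \<Rightarrow> 'a \<Rightarrow> 'a" where
  "shift T \<mu> = (\<lambda>x. T x - \<mu> *\<^sub>C x)"

definition null_space :: "('a::complex_normed_vector \<Rightarrow> 'a) \<Rightarrow> 'a set" where
  "null_space T = {x. T x = 0}"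

definition nullity :: "('a::complex_normed_vector \<Rightarrow> 'a) \<Rightarrow> enat" where
  "nullity T = cdim (null_space T)"

definition deficiency :: "('a::complex_normed_vector \<Rightarrow> 'a) \<Rightarrow> enat" where
  "deficiency T = quotient_dim (range T)"

definition fredholm :: "('a::complex_normed_vector \<Rightarrow> 'a) \<Rightarrow> bool" where
  "fredholm T \<longleftrightarrow> closed (range T) \<and> nullity T < \<infinity> \<and> deficiency T < \<infinity>"

text \<open>Only meaningful when both defect numbers are finite.\<close>

definition fredholm_index :: "('a::complex_normed_vector \<Rightarrow> 'a) \<Rightarrow> int" where
  "fredholm_index T = int (the_enat (nullity T)) - int (the_enat (deficiency T))"

definition weyl :: "('a::complex_normed_vector \<Rightarrow> 'a) \<Rightarrow> bool" where
  "weyl T \<longleftrightarrow> fredholm T \<and> fredholm_index T = 0"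

definition weyl_spectrum :: "('a::complex_normed_vector \<Rightarrow> 'a) \<Rightarrow> complex set" where
  "weyl_spectrum T = {\<mu>. \<not> weyl (shift T \<mu>)}"

definition op_spectrum :: "('a::complex_normed_vector \<Rightarrow> 'a) \<Rightarrow> complex set" where
  "op_spectrum T =
     {\<mu>. \<not> (\<exists>S. bounded_clinear S \<and> S \<circ> shift T \<mu> = id \<and> shift T \<mu> \<circ> S = id)}"

definition pi00 :: "('a::complex_normed_vector \<Rightarrow> 'a) \<Rightarrow> complex set" where
  "pi00 T = {\<mu>. \<mu> isolated_in op_spectrum T \<and>
                0 < nullity (shift T \<mu>) \<and> nullity (shift T \<mu>) < \<infinity>}"

definition weyls_theorem_holds :: "('a::complex_normed_vector \<Rightarrow> 'a) \<Rightarrow> bool" where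
  "weyls_theorem_holds T \<longleftrightarrow> op_spectrum T - weyl_spectrum T = pi00 T"


text \<open>Analyticity on an open set of a vector-valued function, as complex differentiability
  at every point.\<close>

definition vanalytic_on ::
    "(complex \<Rightarrow> 'a::complex_normed_vector) \<Rightarrow> complex set \<Rightarrow> bool"
    (infix \<open>vanalytic'_on\<close> 50) where
  "f vanalytic_on U \<longleftrightarrow> (\<forall>z\<in>U. \<exists>D. (f has_derivative (\<lambda>h. h *\<^sub>C D)) (at z))"

definition SVEP :: "('a::complex_normed_vector \<Rightarrow> 'a) \<Rightarrow> bool" where
  "SVEP T \<longleftrightarrow>
     (\<forall>U f. open U \<longrightarrow> f vanalytic_on U \<longrightarrow> (\<forall>\<mu>\<in>U. shift T \<mu> (f \<mu>) = 0) \<longrightarrow>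
            (\<forall>\<mu>\<in>U. f \<mu> = 0))"

text \<open>Intended for closed \<open>G\<close>, so that \<open>- G\<close> is open.\<close>

definition glocal_subspace ::
    "('a::complex_normed_vector \<Rightarrow> 'a) \<Rightarrow> complex set \<Rightarrow> 'a set" where
  "glocal_subspace T G =
     {x. \<exists>f. f vanalytic_on (- G) \<and> (\<forall>\<mu>\<in>- G. shift T \<mu> (f \<mu>) = x)}"

text \<open>The infimum is taken in the extended reals, so it is \<open>\<infinity>\<close> over the empty set, i.e. when
  the operator \<open>T - \<zeta>\<close> is zero.\<close>

definition reduced_min_modulus ::
    "('a::complex_normed_vector \<Rightarrow> 'a) \<Rightarrow> complex \<Rightarrow> ereal" where
  "reduced_min_modulus T \<zeta> =
     (INF x \<in> - null_space (shift T \<zeta>).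
        ereal (norm (shift T \<zeta> x) / infdist x (null_space (shift T \<zeta>))))"

end

theory Submission
  imports Defs "HOL-Complex_Analysis.Complex_Analysis"
begin

text \<open>Put \<open>A = T - \<mu>\<close>. If \<open>A\<close> has closed range and finite dimensional kernel, then \<open>A\<close> maps
  the intersection of all \<open>R(A\<^sup>n)\<close> onto itself, so a nonzero kernel vector in it would start a backward
  orbit of geometric growth and hence an analytic family of eigenvectors, against SVEP. So
  \<open>N(A)\<close> meets some \<open>R(A\<^sup>p)\<close> trivially, \<open>A\<close> is bounded below on the closed space \<open>R(A\<^sup>p)\<close>, and
  counting dimensions inside \<open>N(A\<^sup>p)\<close> shows that \<open>A\<close> is Weyl iff \<open>X = N(A\<^sup>p) + R(A)\<close>. If this
  holds, \<open>A - \<nu>\<close> is bijective for all small \<open>\<nu> \<noteq> 0\<close>, and conversely such bijectivity forces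
  \<open>A R(A\<^sup>p) = R(A\<^sup>p)\<close> by a perturbation argument; this gives (i) \<open>\<longleftrightarrow>\<close> (ii).
  For (ii) \<open>\<longrightarrow>\<close> (iii), Liouville's theorem shows that the glocal subspace lies in \<open>N(A\<^sup>p)\<close>. For
  (iii) \<open>\<longrightarrow>\<close> (ii), contour integrals of the resolvent give \<open>X = \<X>\<^sub>T({\<mu>}) + R(A)\<close>, and operator
  ranges of finite codimension are closed. For (iv), \<open>\<gamma>\<^sub>T\<close> tends to 0 at an isolated eigenvalue,
  and it is positive at \<open>\<mu>\<close> iff \<open>R(A)\<close> is closed.\<close>

text \<open>The index enters through a single count. Let \<open>K = N(A^p)\<close> with p > 0, where
  N(A) meets R(A^p) trivially. Then K \<inter> R(A) = A K, so the quotient K / A K, of dimension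
  \<alpha>(A) by rank-nullity, embeds into X / R(A). Hence \<beta>(A) is at least \<alpha>(A), with
  equality exactly when K + R(A) = X, and no stability theorem for the index is used. What has to be
  carried between A and A - \<nu> is then only surjectivity on R(A^p), where A is bounded below; one
  estimate does this in both directions. The finite dimension of N(A) has two further effects: the
  spaces N(A) \<inter> R(A^n) stabilise, and all R(A^n) stay closed, because M + N(A) is closed for
  every closed subspace M. The open mapping bound, the closedness of ranges and the perturbation of
  surjectivity all rest on one iteration that turns an approximate solution with relative error 1/2
  into an exact one.\<close>

instance complex_banach \<subseteq> banach ..

section \<open>Open mapping and closed range\<close>

text \<open>Successive correction: each residual \<open>r n\<close> is solved approximately, which
  halves it, and the corrections \<open>g (r n)\<close> form a series dominated by a geometric one
  with sum \<open>2 * C * norm y\<close>. The space \<open>Y\<close> contains all residuals; it will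
  be the image of \<open>M\<close>, the closure of that image, or \<open>M\<close> itself.\<close>

lemma approx_solvable_imp_solvable:
  fixes A :: "'a::banach \<Rightarrow> 'b::real_normed_vector"
  assumes A: "bounded_linear A" and M: "closed M" "subspace M" and Y: "subspace Y" "A ` M \<subseteq> Y"
    and C: "C \<ge> 0"
    and approx: "\<And>y. y \<in> Y \<Longrightarrow> \<exists>x\<in>M. norm x \<le> C * norm y \<and> norm (y - A x) \<le> norm y / 2"
    and y: "y \<in> Y"
  shows "\<exists>x\<in>M. A x = y \<and> norm x \<le> 2 * C * norm y"
proof -
  interpret A: bounded_linear A by (rule A)
  obtain g where g: "\<And>y. y \<in> Y \<Longrightarrow> g y \<in> M \<and> norm (g y) \<le> C * norm y \<and> norm (y - A (g y)) \<le> norm y / 2"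
    using approx by metis
  define r where "r n = ((\<lambda>z. z - A (g z)) ^^ n) y" for n
  have r_Suc: "r (Suc n) = r n - A (g (r n))" and r0: "r 0 = y" for n
    by (simp_all add: r_def)
  have rY: "r n \<in> Y" for n
  proof (induction n)
    case (Suc n)
    then have "A (g (r n)) \<in> Y" using g Y(2) by blast
    with Suc Y(1) show ?case by (simp add: r_Suc subspace_diff)
  qed (simp add: r0 y)
  have rn: "norm (r n) \<le> norm y * (1/2) ^ n" for n
  proof (induction n)
    case (Suc n)
    have "norm (r (Suc n)) \<le> norm (r n) / 2" using g[OF rY[of n]] by (simp add: r_Suc)
    with Suc show ?case by simp
  qed (simp add: r0)
  have gn: "norm (g (r n)) \<le> C * norm y * (1/2) ^ n" for n
  proof -
    have "norm (g (r n)) \<le> C * norm (r n)" using g[OF rY] by blast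
    also have "\<dots> \<le> C * (norm y * (1/2)^n)" using rn C by (rule mult_left_mono)
    finally show ?thesis by (simp add: mult.assoc)
  qed
  have geo: "(\<lambda>n. C * norm y * (1/2::real) ^ n) sums (C * norm y * 2)"
    using sums_mult[OF power_half_series, of "2 * (C * norm y)"]
    by (simp add: mult_ac)
  have sg: "summable (\<lambda>n. g (r n))"
    by (rule summable_comparison_test'[OF sums_summable[OF geo]]) (use gn in auto)
  define x where "x = (\<Sum>n. g (r n))"
  have part: "(\<Sum>i<n. g (r i)) \<in> M" for n
    using g[OF rY] M(2) by (intro subspace_sum) auto
  have lim: "(\<lambda>n. \<Sum>i<n. g (r i)) \<longlonglongrightarrow> x"
    using sg unfolding x_def by (simp add: summable_LIMSEQ)
  have "x \<in> M" by (rule closed_sequentially[OF M(1) part lim])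
  moreover have "A x = y"
  proof -
    have "A (\<Sum>i<n. g (r i)) = y - r n" for n
      by (induction n) (simp_all add: r0 A.zero r_Suc A.add)
    moreover have "r \<longlonglongrightarrow> 0"
    proof (rule Lim_null_comparison)
      show "\<forall>\<^sub>F n in sequentially. norm (r n) \<le> norm y * (1/2) ^ n" using rn by simp
      show "(\<lambda>n. norm y * (1/2::real) ^ n) \<longlonglongrightarrow> 0"
        by (intro tendsto_mult_right_zero LIMSEQ_power_zero) simp
    qed
    then have "(\<lambda>n. y - r n) \<longlonglongrightarrow> y - 0" by (intro tendsto_diff tendsto_const)
    ultimately have "(\<lambda>n. A (\<Sum>i<n. g (r i))) \<longlonglongrightarrow> y" by simp
    with A.tendsto[OF lim] show ?thesis by (rule LIMSEQ_unique)
  qed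
  moreover have "norm x \<le> 2 * C * norm y"
  proof -
    have sn: "summable (\<lambda>n. norm (g (r n)))"
      by (rule summable_comparison_test'[OF sums_summable[OF geo]]) (use gn in auto)
    have "norm x \<le> (\<Sum>n. norm (g (r n)))" unfolding x_def by (rule summable_norm[OF sn])
    also have "\<dots> \<le> C * norm y * 2"
      using suminf_le[OF _ sn sums_summable[OF geo]] gn sums_unique[OF geo] by simp
    finally show ?thesis by simp
  qed
  ultimately show ?thesis by blast
qed

lemma open_mapping_bound:
  fixes A :: "'a::banach \<Rightarrow> 'b::banach"
  assumes A: "bounded_linear A" and M: "closed M" "subspace M" and cl: "closed (A ` M)"
  obtains C where "C > 0" "\<And>y. y \<in> A ` M \<Longrightarrow> \<exists>x\<in>M. A x = y \<and> norm x \<le> C * norm y"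
proof -
  interpret A: bounded_linear A by (rule A)
  define Y where "Y = A ` M"
  have Y: "subspace Y" unfolding Y_def
    by (rule linear_subspace_image[OF A.linear M(2)])
  define K where "K n = Y \<inter> closure (A ` (M \<inter> cball 0 (real n)))" for n
  have "\<exists>n. top_of_set Y interior_of K n \<noteq> {}"
  proof (rule ccontr)
    assume "\<nexists>n. top_of_set Y interior_of K n \<noteq> {}"
    then have "top_of_set Y interior_of \<Union>(range K) = {}"
      using cl unfolding Y_def[symmetric]
      by (intro Baire_category_alt)
        (auto simp: K_def completely_metrizable_space_euclidean
          intro!: completely_metrizable_space_closedin closedin_subtopology_Int_closed
          simp flip: closed_closedin)
    moreover have "\<Union>(range K) = Y"
    proof -
      have "A x \<in> K (nat \<lceil>norm x\<rceil>)" if "x \<in> M" for x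
        using that real_nat_ceiling_ge[of "norm x"]
        by (auto simp: K_def Y_def intro!: subsetD[OF closure_subset])
      then have "Y \<subseteq> \<Union>(range K)" unfolding Y_def by blast
      then show ?thesis by (auto simp: K_def)
    qed
    moreover have "0 \<in> Y" using Y by (rule subspace_0)
    ultimately show False by (metis empty_iff interior_of_topspace topspace_euclidean_subtopology)
  qed
  then obtain n y0 where y0: "y0 \<in> top_of_set Y interior_of K n" by blast
  then obtain e where e: "e > 0" "\<And>y. y \<in> Y \<Longrightarrow> dist y y0 < e \<Longrightarrow> y \<in> K n" and y0Y: "y0 \<in> Y"
  proof -
    from y0 obtain V where V: "openin (top_of_set Y) V" "y0 \<in> V" "V \<subseteq> K n"
      unfolding interior_of_def by blast
    with that show thesis unfolding openin_euclidean_subtopology_iff by blast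
  qed
  have y0K: "y0 \<in> K n" using e y0Y by simp
  have ex: "\<exists>x\<in>M. norm x \<le> n \<and> dist (A x) z < e / 8" if "z \<in> K n" for z
  proof -
    have e8: "e / 8 > 0" using e by simp
    have "z \<in> closure (A ` (M \<inter> cball 0 (real n)))" using that unfolding K_def by (rule IntD2)
    from closure_approachable[THEN iffD1, OF this, rule_format, OF e8] show ?thesis
      by (auto simp del: less_divide_eq_numeral1)
  qed
  \<comment> \<open>A vector \<open>y\<close> is rescaled to length \<open>e / 2\<close>. Two
    approximation errors below \<open>e / 8\<close> add up to at most \<open>e / 4\<close>, half of
    that length. The preimage \<open>x1 - x2\<close> has norm at most \<open>2 * n\<close>, and
    undoing the scaling multiplies it by \<open>2 * norm y / e\<close>.\<close>
  define C where "C = 4 * real n / e"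
  have C: "C \<ge> 0" using e(1) by (simp add: C_def)
  have approx: "\<exists>x\<in>M. norm x \<le> C * norm y \<and> norm (y - A x) \<le> norm y / 2" if y: "y \<in> Y" for y
  proof (cases "y = 0")
    case True
    then show ?thesis using subspace_0[OF M(2)] by (intro bexI[of _ 0]) (auto simp: A.zero)
  next
    case False
    define s where "s = e / (2 * norm y)"
    have s: "s > 0" using False e by (simp add: s_def)
    have sy: "norm (s *\<^sub>R y) = e / 2" using False e by (simp add: s_def)
    have "y0 + s *\<^sub>R y \<in> K n"
      using e(1) sy by (intro e(2) subspace_add Y subspace_scale y0Y y) (auto simp: dist_norm)
    then obtain x1 where x1: "x1 \<in> M" "norm x1 \<le> n" "dist (A x1) (y0 + s *\<^sub>R y) < e / 8"
      using ex by blast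
    obtain x2 where x2: "x2 \<in> M" "norm x2 \<le> n" "dist (A x2) y0 < e / 8"
      using ex[OF y0K] by blast
    have "norm (s *\<^sub>R y - A (x1 - x2)) \<le> e / 4"
    proof -
      have "s *\<^sub>R y - A (x1 - x2) = (A x2 - y0) - (A x1 - (y0 + s *\<^sub>R y))" by (simp add: A.diff)
      then have "norm (s *\<^sub>R y - A (x1 - x2)) \<le> norm (A x2 - y0) + norm (A x1 - (y0 + s *\<^sub>R y))"
        by (metis norm_triangle_ineq4)
      then show ?thesis using x1(3) x2(3) unfolding dist_norm by linarith
    qed
    also have "e / 4 = s * (norm y / 2)" using False by (simp add: s_def)
    finally have *: "norm (s *\<^sub>R y - A (x1 - x2)) \<le> s * (norm y / 2)" .
    have "s *\<^sub>R (y - A ((1/s) *\<^sub>R (x1 - x2))) = s *\<^sub>R y - A (x1 - x2)"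
      using s by (simp add: scaleR_diff_right[of s y] A.scaleR)
    with * s have "s * norm (y - A ((1/s) *\<^sub>R (x1 - x2))) \<le> s * (norm y / 2)"
      by (metis abs_of_pos norm_scaleR)
    then have 1: "norm (y - A ((1/s) *\<^sub>R (x1 - x2))) \<le> norm y / 2" using s by simp
    have "norm (x1 - x2) \<le> 2 * n" using x1(2) x2(2) norm_triangle_ineq4[of x1 x2] by simp
    then have "norm ((1/s) *\<^sub>R (x1 - x2)) \<le> (1/s) * (2 * n)"
      using s by (simp add: divide_right_mono)
    also have "\<dots> = C * norm y" using False e by (simp add: s_def C_def field_simps)
    finally have 2: "norm ((1/s) *\<^sub>R (x1 - x2)) \<le> C * norm y" .
    show ?thesis
      by (rule bexI[of _ "(1/s) *\<^sub>R (x1 - x2)"]) (use 1 2 x1 x2 M(2) in \<open>auto intro: subspace_scale subspace_diff\<close>)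
  qed
  show thesis
  \<comment> \<open>The summand 1 keeps the constant positive when \<open>n = 0\<close> and
    therefore \<open>C = 0\<close>.\<close>
  proof (rule that[of "2 * C + 1"])
    fix y assume "y \<in> A ` M"
    then have "y \<in> Y" by (simp add: Y_def)
    from approx_solvable_imp_solvable[OF A M Y _ C approx this]
    obtain x where "x \<in> M" "A x = y" "norm x \<le> 2 * C * norm y" unfolding Y_def by blast
    moreover have "2 * C * norm y \<le> (2 * C + 1) * norm y" by (simp add: distrib_right)
    ultimately show "\<exists>x\<in>M. A x = y \<and> norm x \<le> (2 * C + 1) * norm y" by fastforce
  qed (use C in simp)
qed

lemma subspace_closure:
  fixes Y :: "'a::real_normed_vector set"
  assumes Y: "subspace Y"
  shows "subspace (closure Y)"
proof (rule subspaceI)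
  show "0 \<in> closure Y" using subspace_0[OF Y] closure_subset by blast
next
  fix x y assume "x \<in> closure Y" "y \<in> closure Y"
  then obtain X Z where "\<And>n. X n \<in> Y" "X \<longlonglongrightarrow> x" "\<And>n. Z n \<in> Y" "Z \<longlonglongrightarrow> y"
    unfolding closure_sequential by blast
  then show "x + y \<in> closure Y" unfolding closure_sequential
    by (intro exI[of _ "\<lambda>n. X n + Z n"]) (auto intro: tendsto_add subspace_add[OF Y])
next
  fix c x assume "x \<in> closure Y"
  then obtain X where "\<And>n. X n \<in> Y" "X \<longlonglongrightarrow> x"
    unfolding closure_sequential by blast
  then show "c *\<^sub>R x \<in> closure Y" unfolding closure_sequential
    by (intro exI[of _ "\<lambda>n. c *\<^sub>R X n"]) (auto intro: tendsto_scaleR subspace_scale[OF Y])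
qed

text \<open>A point \<open>y \<noteq> 0\<close> of the closure has a point \<open>y'\<close> of the
  image within distance \<open>norm y / 2\<close>, and a controlled preimage of \<open>y'\<close> is
  an approximate solution for \<open>y\<close>. Since \<open>norm y' \<le> 2 * norm y\<close>, the
  iteration runs on the whole closure with the constant \<open>2 * C\<close>.\<close>

lemma solvable_bound_imp_closed_range:
  fixes A :: "'a::banach \<Rightarrow> 'b::real_normed_vector"
  assumes A: "bounded_linear A" and M: "closed M" "subspace M" and C: "C \<ge> 0"
    and bound: "\<And>y. y \<in> A ` M \<Longrightarrow> \<exists>x\<in>M. A x = y \<and> norm x \<le> C * norm y"
  shows "closed (A ` M)"
proof -
  interpret A: bounded_linear A by (rule A)
  have Y: "subspace (A ` M)" by (rule linear_subspace_image[OF A.linear M(2)])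
  have "y \<in> A ` M" if y: "y \<in> closure (A ` M)" for y
  proof -
    have "\<exists>x\<in>M. norm x \<le> (2 * C) * norm y \<and> norm (y - A x) \<le> norm y / 2"
      if y: "y \<in> closure (A ` M)" for y
    proof (cases "y = 0")
      case True
      then show ?thesis using subspace_0[OF M(2)] by (intro bexI[of _ 0]) (auto simp: A.zero)
    next
      case False
      then obtain y' where y': "y' \<in> A ` M" "dist y' y < norm y / 2"
        using y unfolding closure_approachable by (metis half_gt_zero zero_less_norm_iff)
      then obtain x where x: "x \<in> M" "A x = y'" "norm x \<le> C * norm y'" using bound by blast
      have "norm y' \<le> 2 * norm y"
        using y'(2) norm_triangle_ineq2[of y' y] by (simp add: dist_norm) (smt (verit) norm_ge_zero)
      then have "C * norm y' \<le> C * (2 * norm y)" using C by (rule mult_left_mono)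
      with x y' show ?thesis by (intro bexI[of _ x]) (auto simp: dist_norm norm_minus_commute)
    qed
    then have "\<exists>x\<in>M. A x = y \<and> norm x \<le> 2 * (2 * C) * norm y"
      by (intro approx_solvable_imp_solvable[OF A M subspace_closure[OF Y] closure_subset])
        (use C y in auto)
    then show ?thesis by blast
  qed
  then show ?thesis using closure_subset_eq by blast
qed

text \<open>A controlled solution of \<open>A x = y\<close> solves \<open>B x = y\<close> up to an
  error of at most \<open>e * C * norm y\<close>, hence up to half of \<open>norm y\<close>. The
  iteration takes the place of a Neumann series, so no inverse of \<open>A\<close> on
  \<open>M\<close> is needed.\<close>

lemma surjective_perturb:
  fixes A B :: "'a::banach \<Rightarrow> 'a"
  assumes B: "bounded_linear B" and M: "closed M" "subspace M" and BM: "B ` M \<subseteq> M"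
    and C: "C \<ge> 0" "\<And>y. y \<in> M \<Longrightarrow> \<exists>x\<in>M. A x = y \<and> norm x \<le> C * norm y"
    and e: "e * C \<le> 1 / 2" "\<And>x. x \<in> M \<Longrightarrow> norm (A x - B x) \<le> e * norm x" "e \<ge> 0"
  shows "B ` M = M"
proof -
  have "\<exists>x\<in>M. B x = y \<and> norm x \<le> 2 * C * norm y" if "y \<in> M" for y
  proof (rule approx_solvable_imp_solvable[OF B M M(2) BM C(1) _ that])
    fix y assume "y \<in> M"
    then obtain x where x: "x \<in> M" "A x = y" "norm x \<le> C * norm y" using C(2) by blast
    have "norm (y - B x) \<le> e * norm x" using e(2) x by blast
    also have "\<dots> \<le> e * (C * norm y)" using x(3) e(3) by (rule mult_left_mono)
    also have "\<dots> \<le> 1/2 * norm y" unfolding mult.assoc[symmetric] using e(1)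
      by (rule mult_right_mono) simp
    finally show "\<exists>x\<in>M. norm x \<le> C * norm y \<and> norm (y - B x) \<le> norm y / 2" using x by auto
  qed
  with BM show ?thesis by fastforce
qed

section \<open>Bounded functionals and analytic functions\<close>

text \<open>Homogeneity is stated as an inequality for positive \<open>t\<close>; applying it to the
  inverse of \<open>t\<close> gives equality. The one-sided form is what an infimum of functionals
  satisfies most directly.\<close>

definition sublinear :: "('a::real_vector \<Rightarrow> real) \<Rightarrow> bool" where
  "sublinear p \<longleftrightarrow> (\<forall>x y. p (x + y) \<le> p x + p y) \<and> (\<forall>t>0. \<forall>x. p (t *\<^sub>R x) \<le> t * p x)"

lemma sublinear_add: "sublinear p \<Longrightarrow> p (x + y) \<le> p x + p y"
  by (simp add: sublinear_def)

lemma sublinear_zero: assumes "sublinear p" shows "p 0 = 0"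
proof -
  have "p ((1/2) *\<^sub>R 0) \<le> 1/2 * p 0" "p (0 + 0) \<le> p 0 + p 0"
    using assms unfolding sublinear_def by (metis half_gt_zero zero_less_one, blast)
  then show ?thesis by simp
qed

lemma sublinear_scaleR: assumes "sublinear p" "t \<ge> 0" shows "p (t *\<^sub>R x) = t * p x"
proof (cases "t = 0")
  case False
  with assms have t: "t > 0" by simp
  have le: "\<And>t x. t > 0 \<Longrightarrow> p (t *\<^sub>R x) \<le> t * p x" using assms(1) by (simp add: sublinear_def)
  have "p (inverse t *\<^sub>R t *\<^sub>R x) \<le> inverse t * p (t *\<^sub>R x)" using t by (intro le) simp
  then have "t * p x \<le> p (t *\<^sub>R x)" using t by (simp add: field_simps)
  with le[OF t] show ?thesis by (simp add: antisym)
qed (simp add: sublinear_zero[OF assms(1)])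

lemma sublinear_ge: assumes "sublinear p" shows "- p (- x) \<le> p x"
  using sublinear_add[OF assms, of x "-x"] sublinear_zero[OF assms] by simp

text \<open>The functional \<open>p\<close> is lowered along the ray spanned by \<open>y\<close>:
  \<open>q x\<close> is the infimum of \<open>p (x + t y) - t * p y\<close> over
  \<open>t \<ge> 0\<close>, bounded below by \<open>- p (- x)\<close>. The parameters 0 and 1 give
  the two bounds. A minimal \<open>p\<close> must coincide with \<open>q\<close>, and the last bound
  then says that \<open>p\<close> is superadditive.\<close>

lemma sublinear_reduce:
  fixes p :: "'a::real_vector \<Rightarrow> real"
  assumes p: "sublinear p"
  obtains q where "sublinear q" "\<And>x. q x \<le> p x" "\<And>x. q x \<le> p (x + y) - p y"
proof -
  define f where "f x t = p (x + t *\<^sub>R y) - t * p y" for x t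
  define q where "q x = (INF t\<in>{0..}. f x t)" for x
  have bdd: "bdd_below (f x ` {0..})" for x
  proof (rule bdd_belowI2)
    fix t :: real assume "t \<in> {0..}"
    then have "t * p y = p ((x + t *\<^sub>R y) + - x)" by (simp add: sublinear_scaleR[OF p])
    also have "\<dots> \<le> p (x + t *\<^sub>R y) + p (- x)" by (rule sublinear_add[OF p])
    finally show "- p (- x) \<le> f x t" by (simp add: f_def)
  qed
  have qf: "q x \<le> f x t" if "t \<ge> 0" for x t
    unfolding q_def using that by (intro cINF_lower[OF bdd]) simp
  have qI: "b \<le> q x" if "\<And>t. t \<ge> 0 \<Longrightarrow> b \<le> f x t" for b x
    unfolding q_def using that by (intro cINF_greatest) auto
  show thesis
  proof (rule that)
    show "sublinear q" unfolding sublinear_def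
    proof (intro conjI allI impI)
      fix x x'
      have "q (x + x') - f x t \<le> q x'" if t: "t \<ge> 0" for t
      proof (rule qI)
        fix t' :: real assume t': "t' \<ge> 0"
        have "q (x + x') \<le> f (x + x') (t + t')" using t t' by (intro qf) simp
        also have "f (x + x') (t + t') = p ((x + t *\<^sub>R y) + (x' + t' *\<^sub>R y)) - (t + t') * p y"
          by (simp add: f_def algebra_simps)
        also have "\<dots> \<le> f x t + f x' t'"
          using sublinear_add[OF p, of "x + t *\<^sub>R y" "x' + t' *\<^sub>R y"]
          by (simp add: f_def algebra_simps)
        finally show "q (x + x') - f x t \<le> f x' t'" by simp
      qed
      then have "q (x + x') - q x' \<le> q x" by (intro qI) (simp add: algebra_simps)
      then show "q (x + x') \<le> q x + q x'" by simp
    next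
      fix s :: real and x assume s: "s > 0"
      have "q (s *\<^sub>R x) / s \<le> f x t" if t: "t \<ge> 0" for t
      proof -
        have "q (s *\<^sub>R x) \<le> f (s *\<^sub>R x) (s * t)" using s t by (intro qf) simp
        also have "\<dots> = p (s *\<^sub>R (x + t *\<^sub>R y)) - s * t * p y" by (simp add: f_def scaleR_add_right)
        also have "p (s *\<^sub>R (x + t *\<^sub>R y)) = s * p (x + t *\<^sub>R y)" using s by (simp only: sublinear_scaleR[OF p])
        also have "s * p (x + t *\<^sub>R y) - s * t * p y = s * f x t" by (simp add: f_def right_diff_distrib)
        finally show ?thesis using s by (simp add: field_simps)
      qed
      then have "q (s *\<^sub>R x) / s \<le> q x" by (rule qI)
      then show "q (s *\<^sub>R x) \<le> s * q x" using s by (simp add: field_simps)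
    qed
    show "q x \<le> p x" for x using qf[of 0 x] by (simp add: f_def)
    show "q x \<le> p (x + y) - p y" for x using qf[of 1 x] by (simp add: f_def)
  qed
qed

text \<open>Zorn's lemma for the reversed pointwise order. The pointwise infimum of a nonempty chain
  is finite because every member is at least \<open>- p0 (- x)\<close> at \<open>x\<close>.\<close>

lemma minimal_sublinear_exists:
  fixes p0 :: "'a::real_vector \<Rightarrow> real"
  assumes p0: "sublinear p0"
  obtains u where "sublinear u" "u \<le> p0" "\<And>q. sublinear q \<Longrightarrow> q \<le> u \<Longrightarrow> q = u"
proof -
  define S where "S = {p. sublinear p \<and> p \<le> p0}"
  define P :: "('a \<Rightarrow> real) \<Rightarrow> ('a \<Rightarrow> real) \<Rightarrow> bool" where "P p q \<longleftrightarrow> q \<le> p" for p q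
  have "\<exists>m\<in>S. \<forall>a\<in>S. P m a \<longrightarrow> a = m"
  proof (rule predicate_Zorn)
    show "partial_order_on S (relation_of P S)"
      by (rule partial_order_on_relation_ofI) (auto simp: P_def)
  next
    fix C assume "C \<in> Chains (relation_of P S)"
    then have C: "C \<subseteq> S" "\<And>p q. p \<in> C \<Longrightarrow> q \<in> C \<Longrightarrow> p \<le> q \<or> q \<le> p"
      by (auto simp: Chains_def relation_of_def P_def)
    show "\<exists>u\<in>S. \<forall>a\<in>C. P a u"
    proof (cases "C = {}")
      case True
      then show ?thesis using p0 by (auto simp: S_def)
    next
      case False
      define u where "u x = (INF p\<in>C. p x)" for x
      have bdd: "bdd_below ((\<lambda>p. p x) ` C)" for x
      proof (rule bdd_belowI2)
        fix p assume "p \<in> C"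
        then have "sublinear p" "p (- x) \<le> p0 (- x)" using C(1) by (auto simp: S_def le_fun_def)
        then show "- p0 (- x) \<le> p x" using sublinear_ge[of p x] by simp
      qed
      have le: "u x \<le> p x" if "p \<in> C" for p x
        unfolding u_def using that by (intro cINF_lower[OF bdd])
      have ge: "b \<le> u x" if "\<And>p. p \<in> C \<Longrightarrow> b \<le> p x" for b x
        unfolding u_def using that False by (intro cINF_greatest) auto
      have sub: "sublinear u" unfolding sublinear_def
      proof (intro conjI allI impI)
        fix x y
        have "u (x + y) - p x \<le> u y" if p: "p \<in> C" for p
        proof (rule ge)
          fix q assume q: "q \<in> C"
          \<comment> \<open>Subadditivity of the infimum needs one functional below both
            \<open>p\<close> and \<open>q\<close>; in a chain the smaller of the two serves.\<close>
          obtain r where r: "r \<in> C" "r \<le> p" "r \<le> q" using C(2)[OF p q] p q by blast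
          have "u (x + y) \<le> r (x + y)" by (rule le[OF r(1)])
          also have "\<dots> \<le> r x + r y" using r(1) C(1) by (intro sublinear_add) (auto simp: S_def)
          also have "\<dots> \<le> p x + q y" using r by (intro add_mono) (auto simp: le_fun_def)
          finally show "u (x + y) - p x \<le> q y" by simp
        qed
        then have "u (x + y) - u y \<le> u x" by (intro ge) (simp add: algebra_simps)
        then show "u (x + y) \<le> u x + u y" by simp
      next
        fix s :: real and x assume s: "s > 0"
        have "u (s *\<^sub>R x) / s \<le> p x" if p: "p \<in> C" for p
        proof -
          have "u (s *\<^sub>R x) \<le> p (s *\<^sub>R x)" by (rule le[OF p])
          also have "\<dots> = s * p x" using s p C(1) by (intro sublinear_scaleR) (auto simp: S_def)
          finally show ?thesis using s by (simp add: field_simps)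
        qed
        then have "u (s *\<^sub>R x) / s \<le> u x" by (rule ge)
        then show "u (s *\<^sub>R x) \<le> s * u x" using s by (simp add: field_simps)
      qed
      obtain p where "p \<in> C" using False by blast
      then have "u \<le> p" "p \<le> p0" using le C(1) by (auto simp: le_fun_def S_def)
      then have "u \<in> S" using sub by (simp add: S_def)
      with le show ?thesis by (auto simp: P_def le_fun_def)
    qed
  qed
  then obtain u where u: "u \<in> S" "\<And>q. q \<in> S \<Longrightarrow> q \<le> u \<Longrightarrow> q = u" unfolding P_def by blast
  show thesis
  proof (rule that)
    show "sublinear u" "u \<le> p0" using u(1) by (simp_all add: S_def)
    fix q assume "sublinear q" "q \<le> u"
    then show "q = u" using \<open>u \<le> p0\<close> by (intro u(2)) (auto simp: S_def)
  qed
qed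

text \<open>Minimal sublinear functionals are linear, so Zorn's lemma gives the Hahn-Banach theorem
  without partially defined functionals.\<close>

lemma real_functional_exists:
  fixes x0 :: "'a::real_normed_vector"
  obtains u :: "'a \<Rightarrow> real" where "linear u" "\<And>x. \<bar>u x\<bar> \<le> norm x" "u x0 = norm x0"
proof -
  have n: "sublinear (norm :: 'a \<Rightarrow> real)" by (simp add: sublinear_def norm_triangle_ineq)
  \<comment> \<open>Lowering the norm along \<open>x0\<close> before minimising forces
    \<open>p (- x0) \<le> - norm x0\<close>. Every linear functional below \<open>p\<close> then
    takes the value \<open>norm x0\<close> at \<open>x0\<close>.\<close>
  obtain p where p: "sublinear p" "\<And>x. p x \<le> norm x" "\<And>x. p x \<le> norm (x + x0) - norm x0"
    using sublinear_reduce[OF n] by blast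
  obtain u where u: "sublinear u" "u \<le> p" and min: "\<And>q. sublinear q \<Longrightarrow> q \<le> u \<Longrightarrow> q = u"
    using minimal_sublinear_exists[OF p(1)] by blast
  have add: "u (x + y) = u x + u y" for x y
  proof -
    obtain q where q: "sublinear q" "\<And>x. q x \<le> u x" "\<And>x. q x \<le> u (x + y) - u y"
      using sublinear_reduce[OF u(1)] by blast
    have "q = u" using q by (intro min) (auto simp: le_fun_def)
    with q(3)[of x] have "u x + u y \<le> u (x + y)" by simp
    with sublinear_add[OF u(1), of x y] show ?thesis by simp
  qed
  have neg: "u (- x) = - u x" for x
    using add[of x "-x"] sublinear_zero[OF u(1)] by simp
  have "u (t *\<^sub>R x) = t * u x" for t x
  proof (cases "t \<ge> 0")
    case False
    then have "u ((- t) *\<^sub>R x) = - t * u x" by (intro sublinear_scaleR[OF u(1)]) simp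
    then show ?thesis by (simp add: neg)
  qed (rule sublinear_scaleR[OF u(1)])
  with add have lin: "linear u" by (intro linearI) auto
  have le: "u x \<le> norm x" for x using le_funD[OF u(2), of x] p(2)[of x] by simp
  have "\<bar>u x\<bar> \<le> norm x" for x using le[of x] le[of "-x"] by (simp add: neg)
  moreover have "u (- x0) \<le> - norm x0"
    using le_funD[OF u(2), of "- x0"] p(3)[of "- x0"] by simp
  then have "u x0 = norm x0" using le[of x0] by (simp add: neg)
  ultimately show thesis using lin that by blast
qed

text \<open>A real functional \<open>u\<close> is the real part of the complex linear functional
  \<open>u x - \<i> * u (\<i> x)\<close>. The crude bound 2 suffices, since only boundedness and
  separation of points are wanted.\<close>

lemma complex_functional_exists:
  fixes x0 :: "'a::complex_normed_vector"
  assumes "x0 \<noteq> 0"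
  obtains \<phi> :: "'a \<Rightarrow> complex" where "bounded_clinear \<phi>" "\<phi> x0 \<noteq> 0"
proof -
  obtain u :: "'a \<Rightarrow> real" where u: "linear u" "\<And>x. \<bar>u x\<bar> \<le> norm x" "u x0 = norm x0"
    using real_functional_exists[of x0] by blast
  interpret u: linear u by (rule u(1))
  define \<phi> where "\<phi> x = Complex (u x) (- u (\<i> *\<^sub>C x))" for x
  have sc: "c *\<^sub>C x = Re c *\<^sub>R x + Im c *\<^sub>R (\<i> *\<^sub>C x)" for c and x :: 'a
  proof -
    have "c *\<^sub>C x = (complex_of_real (Re c) + complex_of_real (Im c) * \<i>) *\<^sub>C x"
      using complex_eq[of c] by (simp add: mult.commute)
    then show ?thesis by (simp only: scaleC_add_left scaleC_of_real flip: scaleC_scaleC)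
  qed
  have ii: "\<i> *\<^sub>C \<i> *\<^sub>C x = - x" for x :: 'a
    using scaleC_of_real[of "-1" x] by (simp add: scaleC_scaleC)
  have iR: "\<i> *\<^sub>C r *\<^sub>R x = r *\<^sub>R \<i> *\<^sub>C x" for r and x :: 'a
    by (simp add: scaleC_scaleC mult.commute flip: scaleC_of_real)
  have cl: "\<phi> (c *\<^sub>C x) = c *\<^sub>C \<phi> x" for c x
    by (simp add: \<phi>_def sc[of c x] scaleC_add_right u.add u.diff u.scale u.neg iR ii scaleC_complex_def
        complex_eq_iff)
  have "bounded_linear \<phi>"
  proof (rule bounded_linear_intro)
    show "\<phi> (x + y) = \<phi> x + \<phi> y" for x y
      by (simp add: \<phi>_def scaleC_add_right u.add complex_eq_iff)
    show "\<phi> (r *\<^sub>R x) = r *\<^sub>R \<phi> x" for r x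
      using cl[of "of_real r" x] by (simp add: scaleC_of_real scaleC_complex_def scaleR_conv_of_real)
    show "norm (\<phi> x) \<le> norm x * 2" for x
    proof -
      have "norm (\<phi> x) \<le> \<bar>u x\<bar> + \<bar>u (\<i> *\<^sub>C x)\<bar>" using cmod_le[of "\<phi> x"] by (simp add: \<phi>_def)
      also have "\<dots> \<le> norm x + norm (\<i> *\<^sub>C x)" by (intro add_mono u(2))
      finally show ?thesis by (simp add: norm_scaleC)
    qed
  qed
  with cl have "bounded_clinear \<phi>" by (simp add: bounded_clinear_def)
  moreover have "Re (\<phi> x0) \<noteq> 0" using u(3) assms by (simp add: \<phi>_def)
  ultimately show thesis using that by fastforce
qed

section \<open>Vector-valued analytic functions: Liouville's theorem and a criterion for
  differentiability\<close>

lemma vanalytic_functional_holomorphic: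
  assumes "f vanalytic_on U" "bounded_clinear \<phi>"
  shows "(\<lambda>z. \<phi> (f z) :: complex) holomorphic_on U"
  unfolding holomorphic_on_def
proof
  fix z assume "z \<in> U"
  then obtain D where "(f has_derivative (\<lambda>h. h *\<^sub>C D)) (at z)"
    using assms(1) unfolding vanalytic_on_def by blast
  moreover have "bounded_linear \<phi>" using assms(2) by (simp add: bounded_clinear_def)
  ultimately have "((\<lambda>z. \<phi> (f z)) has_derivative (\<lambda>h. \<phi> (h *\<^sub>C D))) (at z)"
    by (rule bounded_linear.has_derivative[rotated])
  moreover have "(\<lambda>h. \<phi> (h *\<^sub>C D)) = (*) (\<phi> D)"
    using assms(2) by (simp add: bounded_clinear_def scaleC_complex_def fun_eq_iff)
  ultimately have "((\<lambda>z. \<phi> (f z)) has_field_derivative \<phi> D) (at z)"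
    unfolding has_field_derivative_def by simp
  then show "(\<lambda>z. \<phi> (f z)) field_differentiable (at z within U)"
    using field_differentiable_at_within field_differentiable_def by blast
qed

text \<open>Bounded functionals separate points, so a nonzero value of \<open>f\<close> would
  survive in a scalar entire function that vanishes at infinity.\<close>

lemma vanalytic_Liouville:
  assumes f: "f vanalytic_on UNIV" and lim: "(f \<longlongrightarrow> 0) at_infinity"
  shows "f z = 0"
proof (rule ccontr)
  assume "f z \<noteq> 0"
  then obtain \<phi> :: "'a \<Rightarrow> complex" where \<phi>: "bounded_clinear \<phi>" "\<phi> (f z) \<noteq> 0"
    by (rule complex_functional_exists)
  have bl: "bounded_linear \<phi>" using \<phi>(1) by (simp add: bounded_clinear_def)
  have "((\<lambda>z. \<phi> (f z)) \<longlongrightarrow> \<phi> 0) at_infinity" by (rule bounded_linear.tendsto[OF bl lim])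
  then have "((\<lambda>z. \<phi> (f z)) \<longlongrightarrow> 0) at_infinity"
    using bl by (simp add: linear_simps(3))
  from Liouville_weak_0[OF vanalytic_functional_holomorphic[OF f \<phi>(1)] this, of z] \<phi>(2)
  show False by contradiction
qed

lemma bounded_linear_scaleC_left: "bounded_linear (\<lambda>c. c *\<^sub>C (x::'a::complex_normed_vector))"
proof (rule bounded_linear_intro)
  show "(r *\<^sub>R c) *\<^sub>C x = r *\<^sub>R (c *\<^sub>C x)" for r c
    by (simp add: scaleR_conv_of_real scaleC_scaleC flip: scaleC_of_real)
qed (auto simp: scaleC_add_left norm_scaleC)

text \<open>The power series, the local resolvents and the Cauchy transform below all admit an
  explicit second-order remainder. This criterion reduces their analyticity to a norm
  estimate.\<close>

lemma has_derivative_quadratic_remainder: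
  fixes f :: "complex \<Rightarrow> 'a::complex_normed_vector"
  assumes \<delta>: "\<delta> > 0"
    and rem: "\<And>w. dist w z < \<delta> \<Longrightarrow> norm (f w - f z - (w - z) *\<^sub>C D) \<le> K * (norm (w - z))\<^sup>2"
  shows "(f has_derivative (\<lambda>h. h *\<^sub>C D)) (at z)"
  unfolding has_derivative_at'
proof (intro conjI allI impI)
  fix e :: real assume e: "e > 0"
  show "\<exists>d>0. \<forall>x'. 0 < norm (x' - z) \<and> norm (x' - z) < d \<longrightarrow>
      norm (f x' - f z - (x' - z) *\<^sub>C D) / norm (x' - z) < e"
  proof (intro exI[of _ "min \<delta> (e / (\<bar>K\<bar> + 1))"] conjI allI impI)
    fix w assume w: "0 < norm (w - z) \<and> norm (w - z) < min \<delta> (e / (\<bar>K\<bar> + 1))"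
    have "norm (f w - f z - (w - z) *\<^sub>C D) \<le> K * (norm (w - z))\<^sup>2" using w by (intro rem) (simp add: dist_norm)
    also have "\<dots> \<le> (\<bar>K\<bar> + 1) * (norm (w - z))\<^sup>2" by (intro mult_right_mono) auto
    also have "\<dots> = ((\<bar>K\<bar> + 1) * norm (w - z)) * norm (w - z)" by (simp add: power2_eq_square)
    also have "\<dots> < e * norm (w - z)"
    proof (rule mult_strict_right_mono)
      have "norm (w - z) < e / (\<bar>K\<bar> + 1)" using w by simp
      then show "(\<bar>K\<bar> + 1) * norm (w - z) < e" by (simp add: field_simps)
    qed (use w in simp)
    finally show "norm (f w - f z - (w - z) *\<^sub>C D) / norm (w - z) < e"
      using w by (simp add: field_simps)
  qed (use \<delta> e in auto)
qed (rule bounded_linear_scaleC_left)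

section \<open>Finite dimensional subspaces and codimension\<close>

lemma csubspace_imp_subspace:
  "complex_vector.subspace V \<Longrightarrow> subspace V"
  unfolding complex_vector.subspace_def subspace_def by (metis scaleC_of_real)

lemma bounded_clinear_linear:
  "bounded_clinear A \<Longrightarrow> Vector_Spaces.linear scaleC scaleC A"
  by (auto simp: bounded_clinear_def Vector_Spaces.linear_iff bounded_linear.linear linear_add
      complex_vector.vector_space_axioms)

lemma bounded_clinear_bounded_linear: "bounded_clinear A \<Longrightarrow> bounded_linear A"
  by (simp add: bounded_clinear_def)

lemma fin_dim_basis:
  assumes "fin_dim V"
  obtains B where "finite B" "complex_vector.independent B" "B \<subseteq> V" "complex_vector.span B = V"
    "card B = complex_vector.dim V"
proof -
  obtain S where S: "finite S" "complex_vector.span S = V" using assms by (auto simp: fin_dim_def)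
  obtain B where B: "B \<subseteq> S" "complex_vector.independent B" "S \<subseteq> complex_vector.span B"
    using complex_vector.maximal_independent_subset by blast
  have "complex_vector.span B = V"
    using B S complex_vector.span_minimal[OF B(3)] complex_vector.span_mono[OF B(1)] by auto
  with B S show thesis
    by (intro that[of B]) (auto intro: finite_subset complex_vector.span_base
        simp flip: complex_vector.dim_span_eq_card_independent)
qed

lemma fin_dim_subspace: "fin_dim V \<Longrightarrow> complex_vector.subspace V"
  by (auto simp: fin_dim_def)

lemma fin_dim_subset:
  assumes "fin_dim V" "complex_vector.subspace W" "W \<subseteq> V"
  shows "fin_dim W"
proof -
  obtain B where B: "finite B" "complex_vector.span B = V" using assms(1) by (auto simp: fin_dim_def)
  obtain S where S: "S \<subseteq> W" "complex_vector.independent S" "W \<subseteq> complex_vector.span S"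
    using complex_vector.maximal_independent_subset by blast
  have "finite S" using complex_vector.independent_span_bound[OF B(1) S(2)] S(1) assms(3) B(2) by auto
  moreover have "complex_vector.span S = W" using S assms(2) by (intro complex_vector.span_subspace)
  ultimately show ?thesis unfolding fin_dim_def by blast
qed

lemma independent_card_eq_imp_span_eq:
  assumes "finite B" "complex_vector.independent S" "S \<subseteq> complex_vector.span B" "card B \<le> card S"
  shows "complex_vector.span S = complex_vector.span B"
proof (rule ccontr)
  assume ne: "complex_vector.span S \<noteq> complex_vector.span B"
  have "complex_vector.span S \<subseteq> complex_vector.span B"
    using assms(3) by (rule complex_vector.span_minimal) (rule complex_vector.subspace_span)
  with ne obtain b where b: "b \<in> complex_vector.span B" "b \<notin> complex_vector.span S" by blast
  have "complex_vector.independent (insert b S)"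
    using b(2) assms(2) by (rule complex_vector.independent_insertI)
  then have "finite (insert b S) \<and> card (insert b S) \<le> card B"
    using b(1) assms(3) by (intro complex_vector.independent_span_bound[OF assms(1)]) auto
  moreover have "b \<notin> S" using b(2) complex_vector.span_base by blast
  ultimately show False using assms(4) by (auto simp: card_insert_if)
qed

lemma fin_dim_eq_of_dim_le:
  assumes "fin_dim V" "complex_vector.subspace W" "W \<subseteq> V"
    and "complex_vector.dim V \<le> complex_vector.dim W"
  shows "W = V"
proof -
  obtain B where B: "finite B" "complex_vector.span B = V" "card B = complex_vector.dim V"
    using fin_dim_basis[OF assms(1)] by metis
  obtain S where S: "complex_vector.independent S" "S \<subseteq> W" "complex_vector.span S = W"
      "card S = complex_vector.dim W"
    using fin_dim_basis[OF fin_dim_subset[OF assms(1-3)]] by metis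
  show ?thesis using independent_card_eq_imp_span_eq[OF B(1) S(1)] B S assms by auto
qed

text \<open>The index \<open>p\<close> is chosen with the dimension of \<open>V p\<close> least; a
  subspace of \<open>V p\<close> of no smaller dimension is all of \<open>V p\<close>.\<close>

lemma decreasing_subspaces_stabilize:
  assumes "fin_dim W" "\<And>n. complex_vector.subspace (V n)" "\<And>n. V n \<subseteq> W" "decseq V"
  obtains p where "\<And>n. n \<ge> p \<Longrightarrow> V n = V p"
proof -
  obtain p where p: "\<And>n. complex_vector.dim (V p) \<le> complex_vector.dim (V n)"
    using ex_has_least_nat[of "\<lambda>_. True" 0 "\<lambda>n. complex_vector.dim (V n)"] by auto
  have "V n = V p" if "n \<ge> p" for n
  proof (rule fin_dim_eq_of_dim_le)
    show "fin_dim (V p)" using assms(1,2,3) by (rule fin_dim_subset)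
    show "V n \<subseteq> V p" using assms(4) that by (auto simp: decseq_def)
  qed (use assms p in auto)
  then show thesis by (rule that)
qed

lemma independent_Un_span_Int:
  assumes "complex_vector.independent (S \<union> T)" "finite S" "finite T" "S \<inter> T = {}"
  shows "complex_vector.span S \<inter> complex_vector.span T = {0}"
proof -
  have "x = 0" if x: "x \<in> complex_vector.span S" "x \<in> complex_vector.span T" for x
  proof -
    obtain u where u: "x = (\<Sum>v\<in>S. u v *\<^sub>C v)"
      using x(1) assms(2) by (auto simp: complex_vector.span_finite)
    obtain w where w: "x = (\<Sum>v\<in>T. w v *\<^sub>C v)"
      using x(2) assms(3) by (auto simp: complex_vector.span_finite)
    \<comment> \<open>Two representations of one vector, over \<open>S\<close> and over
      \<open>T\<close>, are glued with opposite signs into a vanishing combination over the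
      independent union.\<close>
    define f where "f v = (if v \<in> S then u v else - w v)" for v
    have "(\<Sum>v\<in>S \<union> T. f v *\<^sub>C v) = (\<Sum>v\<in>S. f v *\<^sub>C v) + (\<Sum>v\<in>T. f v *\<^sub>C v)"
      using assms by (intro sum.union_disjoint)
    also have "(\<Sum>v\<in>S. f v *\<^sub>C v) = x" unfolding u by (intro sum.cong) (auto simp: f_def)
    also have "(\<Sum>v\<in>T. f v *\<^sub>C v) = - x" unfolding w sum_negf[symmetric]
      using assms(4) by (intro sum.cong) (auto simp: f_def complex_vector.scale_minus_left)
    finally have "(\<Sum>v\<in>S \<union> T. f v *\<^sub>C v) = 0" by simp
    then have "f v = 0" if "v \<in> S" for v
      using complex_vector.independentD[OF assms(1) _ subset_refl] assms(2,3) that by blast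
    then show "x = 0" unfolding u by (intro sum.neutral) (auto simp: f_def)
  qed
  then show ?thesis using complex_vector.span_zero by blast
qed

section \<open>Bases of a quotient, expressed by spans of representatives\<close>

lemma quotient_basis_iff:
  assumes R: "complex_vector.subspace R"
  shows "quotient_basis R B \<longleftrightarrow> finite B \<and> complex_vector.independent B \<and>
    complex_vector.span B \<inter> R \<subseteq> {0} \<and> (\<forall>x. \<exists>w\<in>complex_vector.span B. x - w \<in> R)"
proof (cases "finite B")
  case True
  have "(\<forall>c. (\<Sum>b\<in>B. c b *\<^sub>C b) \<in> R \<longrightarrow> (\<forall>b\<in>B. c b = 0)) \<longleftrightarrow>
      complex_vector.independent B \<and> complex_vector.span B \<inter> R \<subseteq> {0}"
  proof (intro iffI conjI allI impI)
    assume *: "\<forall>c. (\<Sum>b\<in>B. c b *\<^sub>C b) \<in> R \<longrightarrow> (\<forall>b\<in>B. c b = 0)"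
    show "complex_vector.independent B"
      unfolding complex_vector.dependent_finite[OF True]
      using * complex_vector.subspace_0[OF R] by (metis)
    show "complex_vector.span B \<inter> R \<subseteq> {0}"
      using * by (auto simp: complex_vector.span_finite[OF True])
  next
    fix c assume *: "complex_vector.independent B \<and> complex_vector.span B \<inter> R \<subseteq> {0}"
      and c: "(\<Sum>b\<in>B. c b *\<^sub>C b) \<in> R"
    then have "(\<Sum>b\<in>B. c b *\<^sub>C b) = 0" by (auto simp: complex_vector.span_finite[OF True])
    with * show "\<forall>b\<in>B. c b = 0" using complex_vector.dependent_finite[OF True] by blast
  qed
  then show ?thesis using True unfolding quotient_basis_def
    by (auto simp: complex_vector.span_finite[OF True])
qed (simp add: quotient_basis_def)

text \<open>Steinitz exchange modulo \<open>R\<close>, carried out in the space itself. The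
  projection \<open>\<pi>\<close> onto the span of \<open>B\<close> along \<open>R\<close> is linear
  with kernel \<open>R\<close>, hence injective on the span of \<open>C\<close>, so cardinalities
  can be compared inside the span of \<open>B\<close>.\<close>

lemma quotient_basis_exchange:
  assumes R: "complex_vector.subspace R" and B: "quotient_basis R B"
    and C: "complex_vector.independent C" "complex_vector.span C \<inter> R \<subseteq> {0}"
  shows "card C \<le> card B" and "card C = card B \<Longrightarrow> finite C \<Longrightarrow> quotient_basis R C"
proof -
  have B': "finite B" "complex_vector.span B \<inter> R \<subseteq> {0}" "\<And>x. \<exists>w\<in>complex_vector.span B. x - w \<in> R"
    using B unfolding quotient_basis_iff[OF R] by blast+
  obtain \<pi> where \<pi>: "\<And>x. \<pi> x \<in> complex_vector.span B" "\<And>x. x - \<pi> x \<in> R" using B'(3) by metis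
  have uniq: "\<pi> x = w" if "w \<in> complex_vector.span B" "x - w \<in> R" for x w
  proof -
    have "\<pi> x - w \<in> complex_vector.span B" using \<pi> that by (intro complex_vector.span_diff)
    moreover have "\<pi> x - w \<in> R" using complex_vector.subspace_diff[OF R that(2) \<pi>(2)[of x]] by simp
    ultimately show ?thesis using B'(2) by auto
  qed
  have lin: "Vector_Spaces.linear scaleC scaleC \<pi>"
    unfolding Vector_Spaces.linear_iff
  proof (intro conjI allI uniq)
    fix x y
    show "\<pi> x + \<pi> y \<in> complex_vector.span B" using \<pi> by (intro complex_vector.span_add)
    show "x + y - (\<pi> x + \<pi> y) \<in> R"
      using complex_vector.subspace_add[OF R \<pi>(2)[of x] \<pi>(2)[of y]] by (simp add: algebra_simps)
  next
    fix c x
    show "c *\<^sub>C \<pi> x \<in> complex_vector.span B" using \<pi> by (intro complex_vector.span_scale)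
    show "c *\<^sub>C x - c *\<^sub>C \<pi> x \<in> R"
      using complex_vector.subspace_scale[OF R \<pi>(2)[of x]]
      by (simp add: complex_vector.scale_right_diff_distrib)
  qed (rule complex_vector.vector_space_axioms)+
  interpret \<pi>: Vector_Spaces.linear scaleC scaleC \<pi> by (rule lin)
  have eqD: "x - y \<in> R" if "\<pi> x = \<pi> y" for x y
    using complex_vector.subspace_diff[OF R \<pi>(2)[of x] \<pi>(2)[of y]] that by simp
  have inj: "inj_on \<pi> (complex_vector.span C)"
  proof (rule inj_onI)
    fix x y assume xy: "x \<in> complex_vector.span C" "y \<in> complex_vector.span C" "\<pi> x = \<pi> y"
    have "x - y \<in> complex_vector.span C" using xy by (intro complex_vector.span_diff)
    with eqD[OF xy(3)] C(2) show "x = y" by auto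
  qed
  have ind: "complex_vector.independent (\<pi> ` C)" by (rule \<pi>.independent_injective_image[OF C(1) inj])
  have card: "card (\<pi> ` C) = card C"
    using inj complex_vector.span_superset by (metis card_image inj_on_subset)
  have sub: "\<pi> ` C \<subseteq> complex_vector.span B" using \<pi> by blast
  show "card C \<le> card B" using complex_vector.independent_span_bound[OF B'(1) ind sub] card by simp
  assume eq: "card C = card B" and fin: "finite C"
  have "complex_vector.span (\<pi> ` C) = complex_vector.span B"
    by (rule independent_card_eq_imp_span_eq[OF B'(1) ind sub]) (simp add: card eq)
  then have sp: "\<pi> ` complex_vector.span C = complex_vector.span B" by (simp add: \<pi>.span_image)
  have "\<exists>w\<in>complex_vector.span C. x - w \<in> R" for x
  proof -
    have "\<pi> x \<in> \<pi> ` complex_vector.span C" using \<pi>(1) sp by simp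
    then show ?thesis using eqD by blast
  qed
  with C fin show "quotient_basis R C" by (simp add: quotient_basis_iff[OF R])
qed

text \<open>Makes the choice of a basis in \<open>quotient_dim\<close> irrelevant: by exchange in
  both directions all quotient bases have the same size.\<close>

lemma quotient_dim_eq_card:
  assumes R: "complex_vector.subspace R" and B: "quotient_basis R B"
  shows "quotient_dim R = enat (card B)"
proof -
  have le: "card C \<le> card D" if "quotient_basis R C" "quotient_basis R D" for C D
    using that by (intro quotient_basis_exchange(1)[OF R]) (auto simp: quotient_basis_iff[OF R])
  have "quotient_basis R (SOME B. quotient_basis R B)" using B by (rule someI)
  with B le have "card (SOME B. quotient_basis R B) = card B" by (intro antisym) auto
  then show ?thesis using B by (auto simp: quotient_dim_def)
qed

text \<open>Rank-nullity for \<open>A\<close> restricted to \<open>K\<close>.\<close>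

lemma invariant_fin_dim_complement:
  assumes A: "Vector_Spaces.linear scaleC scaleC A"
    and K: "fin_dim K" "A ` K \<subseteq> K" "null_space A \<subseteq> K"
  obtains C where "finite C" "C \<subseteq> K" "complex_vector.independent C"
    "card C = complex_vector.dim (null_space A)"
    "complex_vector.span C \<inter> A ` K = {0}"
    "\<And>x. x \<in> K \<Longrightarrow> \<exists>w\<in>complex_vector.span C. x - w \<in> A ` K"
proof -
  interpret A: Vector_Spaces.linear scaleC scaleC A by (rule A)
  obtain BK where BK: "finite BK" "complex_vector.span BK = K" "card BK = complex_vector.dim K"
    using fin_dim_basis[OF K(1)] by metis
  have sub: "complex_vector.subspace (null_space A)" unfolding null_space_def by (rule A.subspace_kernel)
  obtain B0 where B0: "finite B0" "complex_vector.independent B0" "complex_vector.span B0 = null_space A"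
      "card B0 = complex_vector.dim (null_space A)" "B0 \<subseteq> null_space A"
    using fin_dim_basis[OF fin_dim_subset[OF K(1) sub K(3)]] by metis
  have "B0 \<subseteq> K" using B0(5) K(3) by blast
  then obtain B where B: "B0 \<subseteq> B" "B \<subseteq> K" "complex_vector.independent B" "K \<subseteq> complex_vector.span B"
    using B0(2) by (rule complex_vector.maximal_independent_subset_extend)
  have subK: "complex_vector.subspace K" using K(1) by (rule fin_dim_subspace)
  have spB: "complex_vector.span B = K" using B(2,4) subK by (rule complex_vector.span_subspace)
  have finB: "finite B" "card B = card BK"
    using complex_vector.independent_span_bound[OF BK(1) B(3)] B(2) BK(2,3)
      complex_vector.basis_card_eq_dim[OF B(2,4,3)] by auto
  define B1 where "B1 = B - B0"
  have B1: "B = B0 \<union> B1" "B0 \<inter> B1 = {}" "finite B1" using B(1) finB(1) by (auto simp: B1_def)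
  have "complex_vector.independent B1" using complex_vector.independent_mono[OF B(3)] by (simp add: B1_def)
  have int: "complex_vector.span B0 \<inter> complex_vector.span B1 = {0}"
    using independent_Un_span_Int[of B0 B1] B(3) B1 B0(1) by simp
  have inj: "inj_on A (complex_vector.span B1)"
  proof (rule inj_onI)
    fix x y assume xy: "x \<in> complex_vector.span B1" "y \<in> complex_vector.span B1" "A x = A y"
    then have "x - y \<in> complex_vector.span B0 \<inter> complex_vector.span B1"
      by (auto simp: B0(3) null_space_def A.diff intro: complex_vector.span_diff)
    with int show "x = y" by auto
  qed
  have ind1: "complex_vector.independent (A ` B1)"
    by (rule A.independent_injective_image[OF \<open>complex_vector.independent B1\<close> inj])
  have card1: "card (A ` B1) = card B1"
    using inj complex_vector.span_superset by (metis card_image inj_on_subset)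
  have AK: "complex_vector.span (A ` B1) = A ` K"
  proof
    have "A ` B1 \<subseteq> A ` K" using B(2) by (auto simp: B1_def)
    then show "complex_vector.span (A ` B1) \<subseteq> A ` K"
      by (rule complex_vector.span_minimal) (rule A.subspace_image[OF subK])
    show "A ` K \<subseteq> complex_vector.span (A ` B1)"
    proof
      fix y assume "y \<in> A ` K"
      then obtain x where x: "x \<in> complex_vector.span (B0 \<union> B1)" "y = A x" using spB B1(1) by auto
      then obtain x0 x1 where "x0 \<in> complex_vector.span B0" "x1 \<in> complex_vector.span B1" "x = x0 + x1"
        unfolding complex_vector.span_Un by blast
      then have "y = A x1" using x(2) by (auto simp: B0(3) null_space_def A.add)
      then show "y \<in> complex_vector.span (A ` B1)"
        using \<open>x1 \<in> _\<close> by (simp add: A.span_image)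
    qed
  qed
  have "A ` B1 \<subseteq> K" using K(2) B(2) by (auto simp: B1_def)
  then obtain D where D: "A ` B1 \<subseteq> D" "D \<subseteq> K" "complex_vector.independent D" "K \<subseteq> complex_vector.span D"
    using ind1 by (rule complex_vector.maximal_independent_subset_extend)
  have spD: "complex_vector.span D = K" using D(2,4) subK by (rule complex_vector.span_subspace)
  have finD: "finite D" "card D = card BK"
    using complex_vector.independent_span_bound[OF BK(1) D(3)] D(2) BK(2,3)
      complex_vector.basis_card_eq_dim[OF D(2,4,3)] by auto
  \<comment> \<open>Both \<open>B\<close>, the union of \<open>B0\<close> and \<open>B1\<close>, and
    \<open>D\<close>, the union of \<open>C\<close> and the injective image of \<open>B1\<close>,
    are bases of \<open>K\<close>. Cancelling the common number of elements of \<open>B1\<close>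
    leaves as many vectors in \<open>C\<close> as in the basis \<open>B0\<close> of the
    kernel.\<close>
  define C where "C = D - A ` B1"
  have DC: "D = C \<union> A ` B1" "C \<inter> A ` B1 = {}" "finite C" using D(1) finD(1) by (auto simp: C_def)
  show thesis
  proof (rule that)
    show "finite C" "C \<subseteq> K" using DC D(2) by auto
    show "complex_vector.independent C" using complex_vector.independent_mono[OF D(3)] by (simp add: C_def)
    have "card D = card C + card (A ` B1)" using DC B1(3) by (simp add: card_Un_disjoint)
    moreover have "card B = card B0 + card B1" using B1 B0(1) by (simp add: card_Un_disjoint)
    ultimately show "card C = complex_vector.dim (null_space A)" using finB finD card1 B0(4) by simp
    show "complex_vector.span C \<inter> A ` K = {0}"
      using independent_Un_span_Int[of C "A ` B1"] D(3) DC B1(3) AK by simp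
    show "\<exists>w\<in>complex_vector.span C. x - w \<in> A ` K" if "x \<in> K" for x
    proof -
      have "x \<in> complex_vector.span (C \<union> A ` B1)" using that spD DC(1) by simp
      then obtain w y where "w \<in> complex_vector.span C" "y \<in> A ` K" "x = w + y"
        unfolding complex_vector.span_Un AK by blast
      then show ?thesis by (intro bexI[of _ w]) auto
    qed
  qed
qed

lemma weyl_iff_fin_dim_sum:
  assumes A: "bounded_clinear A" and cl: "closed (range A)"
    and K: "fin_dim K" "A ` K \<subseteq> K" "null_space A \<subseteq> K" "K \<inter> range A \<subseteq> A ` K"
  shows "weyl A \<longleftrightarrow> (\<forall>x. \<exists>k\<in>K. x - k \<in> range A)"
proof -
  have lin: "Vector_Spaces.linear scaleC scaleC A" using A by (rule bounded_clinear_linear)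
  interpret A: Vector_Spaces.linear scaleC scaleC A by (rule lin)
  have R: "complex_vector.subspace (range A)" by (rule A.subspace_image[OF complex_vector.subspace_UNIV])
  have subK: "complex_vector.subspace K" using K(1) by (rule fin_dim_subspace)
  have "complex_vector.subspace (null_space A)" unfolding null_space_def by (rule A.subspace_kernel)
  then have "fin_dim (null_space A)" using K(1,3) by (metis fin_dim_subset)
  then have nul: "nullity A = enat (complex_vector.dim (null_space A))"
    by (simp add: nullity_def cdim_def)
  obtain C where C: "finite C" "C \<subseteq> K" "complex_vector.independent C"
    "card C = complex_vector.dim (null_space A)"
    "complex_vector.span C \<inter> A ` K = {0}"
    "\<And>x. x \<in> K \<Longrightarrow> \<exists>w\<in>complex_vector.span C. x - w \<in> A ` K"
    using invariant_fin_dim_complement[OF lin K(1-3)] by metis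
  have spC: "complex_vector.span C \<subseteq> K" by (rule complex_vector.span_minimal[OF C(2) subK])
  have int: "complex_vector.span C \<inter> range A \<subseteq> {0}" using spC K(4) C(5) by blast
  show ?thesis
  proof
    assume w: "weyl A"
    then have "quotient_dim (range A) < \<infinity>" by (simp add: weyl_def fredholm_def deficiency_def)
    then obtain B where B: "quotient_basis (range A) B" by (auto simp: quotient_dim_def split: if_splits)
    have "card C = card B"
      using w quotient_dim_eq_card[OF R B] nul C(4)
      by (simp add: weyl_def fredholm_index_def deficiency_def)
    then have "quotient_basis (range A) C"
      using quotient_basis_exchange(2)[OF R B C(3) int] C(1) by simp
    then show "\<forall>x. \<exists>k\<in>K. x - k \<in> range A" using spC unfolding quotient_basis_iff[OF R] by blast
  next
    assume sum: "\<forall>x. \<exists>k\<in>K. x - k \<in> range A"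
    have "\<exists>w\<in>complex_vector.span C. x - w \<in> range A" for x
    proof -
      obtain k where k: "k \<in> K" "x - k \<in> range A" using sum by blast
      obtain w where w: "w \<in> complex_vector.span C" "k - w \<in> A ` K" using C(6)[OF k(1)] by blast
      have "(x - k) + (k - w) \<in> range A" using k(2) w(2) by (intro complex_vector.subspace_add[OF R]) auto
      with w(1) show ?thesis by auto
    qed
    then have "quotient_basis (range A) C" using C(1,3) int by (simp add: quotient_basis_iff[OF R])
    from quotient_dim_eq_card[OF R this] show "weyl A"
      using cl nul C(4) by (simp add: weyl_def fredholm_def fredholm_index_def deficiency_def)
  qed
qed

text \<open>A basis of the kernel together with one preimage for each element of a basis of
  \<open>V \<inter> range A\<close> spans the preimage of \<open>V\<close>.\<close>

lemma fin_dim_vimage: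
  assumes A: "Vector_Spaces.linear scaleC scaleC A"
    and N: "fin_dim (null_space A)" and V: "fin_dim V"
  shows "fin_dim (A -` V)"
proof -
  interpret A: Vector_Spaces.linear scaleC scaleC A by (rule A)
  have subV: "complex_vector.subspace V" using V by (rule fin_dim_subspace)
  have sub: "complex_vector.subspace (A -` V)" by (rule A.subspace_vimage[OF subV])
  have "complex_vector.subspace (range A)" by (rule A.subspace_image[OF complex_vector.subspace_UNIV])
  then have "fin_dim (V \<inter> range A)"
    using subV by (intro fin_dim_subset[OF V]) (auto intro: complex_vector.subspace_inter)
  then obtain B where B: "finite B" "B \<subseteq> V \<inter> range A" "complex_vector.span B = V \<inter> range A"
    by (rule fin_dim_basis)
  obtain g where g: "\<And>b. b \<in> B \<Longrightarrow> A (g b) = b" using B(2) by (metis IntD2 f_inv_into_f subsetD)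
  obtain B0 where B0: "finite B0" "complex_vector.span B0 = null_space A"
    using N by (auto simp: fin_dim_def)
  have "A -` V \<subseteq> complex_vector.span (B0 \<union> g ` B)"
  proof
    fix x assume "x \<in> A -` V"
    then have "A x \<in> complex_vector.span (A ` g ` B)" using g B(3) by (simp add: image_image)
    then obtain w where w: "w \<in> complex_vector.span (g ` B)" "A x = A w" by (auto simp: A.span_image)
    have "x - w \<in> complex_vector.span B0" using w(2) by (simp add: B0(2) null_space_def A.diff)
    moreover have "x = (x - w) + w" by simp
    ultimately show "x \<in> complex_vector.span (B0 \<union> g ` B)"
      unfolding complex_vector.span_Un using w(1) by blast
  qed
  moreover have "fin_dim (complex_vector.span (B0 \<union> g ` B))"
    using B(1) B0(1) unfolding fin_dim_def by (intro exI[of _ "B0 \<union> g ` B"]) simp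
  ultimately show ?thesis using sub by (metis fin_dim_subset)
qed

text \<open>For \<open>v\<close> outside \<open>M\<close> the coefficient of \<open>v\<close> is
  controlled by the whole sum, with the reciprocal of the distance from \<open>v\<close> to
  \<open>M\<close> as constant. Convergence of the sums therefore forces convergence of the
  coefficients, and then of the parts in \<open>M\<close>.\<close>

lemma closed_subspace_add_line:
  fixes M :: "'a::complex_normed_vector set"
  assumes M: "closed M" "complex_vector.subspace M"
  shows "closed {m + c *\<^sub>C v | m c. m \<in> M}"
proof (cases "v \<in> M")
  case True
  have "{m + c *\<^sub>C v | m c. m \<in> M} = M"
  proof (intro equalityI subsetI)
    fix x assume "x \<in> M"
    then have "x = x + 0 *\<^sub>C v" by simp
    with \<open>x \<in> M\<close> show "x \<in> {m + c *\<^sub>C v | m c. m \<in> M}" by blast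
  qed (use True M(2) in \<open>auto intro: complex_vector.subspace_add complex_vector.subspace_scale\<close>)
  with M show ?thesis by simp
next
  case False
  have "M \<noteq> {}" using complex_vector.subspace_0[OF M(2)] by blast
  then have d: "infdist v M > 0" using False M(1) by (simp add: infdist_pos_not_in_closed)
  have ge: "cmod c * infdist v M \<le> norm (m + c *\<^sub>C v)" if "m \<in> M" for m c
  proof (cases "c = 0")
    case c: False
    have "- (inverse c *\<^sub>C m) \<in> M"
      using that M(2) by (intro complex_vector.subspace_neg complex_vector.subspace_scale)
    then have "infdist v M \<le> dist v (- (inverse c *\<^sub>C m))" by (rule infdist_le)
    then have "cmod c * infdist v M \<le> cmod c * norm (v + inverse c *\<^sub>C m)"
      by (intro mult_left_mono) (auto simp: dist_norm)
    also have "\<dots> = norm (c *\<^sub>C (v + inverse c *\<^sub>C m))" by (simp add: norm_scaleC)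
    also have "c *\<^sub>C (v + inverse c *\<^sub>C m) = m + c *\<^sub>C v"
      using c by (simp add: scaleC_add_right scaleC_scaleC)
    finally show ?thesis .
  qed simp
  show ?thesis unfolding closed_sequential_limits
  proof (intro allI impI, elim conjE)
    fix X x assume X: "\<forall>n. X n \<in> {m + c *\<^sub>C v | m c. m \<in> M}" "X \<longlonglongrightarrow> x"
    then have "\<forall>n. \<exists>m c. m \<in> M \<and> X n = m + c *\<^sub>C v" by blast
    then obtain m c where mc: "\<And>n. m n \<in> M" "\<And>n. X n = m n + c n *\<^sub>C v" by metis
    have "Cauchy X" using X(2) by (rule LIMSEQ_imp_Cauchy)
    have "Cauchy c"
    proof (rule CauchyI)
      fix e :: real assume "e > 0"
      then obtain N where N: "\<And>i j. i \<ge> N \<Longrightarrow> j \<ge> N \<Longrightarrow> norm (X i - X j) < e * infdist v M"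
        using CauchyD[OF \<open>Cauchy X\<close>, of "e * infdist v M"] d by auto
      have "norm (c i - c j) < e" if "i \<ge> N" "j \<ge> N" for i j
      proof -
        have "X i - X j = (m i - m j) + (c i - c j) *\<^sub>C v"
          by (simp add: mc complex_vector.scale_left_diff_distrib)
        then have "cmod (c i - c j) * infdist v M \<le> norm (X i - X j)"
          using ge[of "m i - m j" "c i - c j"] complex_vector.subspace_diff[OF M(2) mc(1) mc(1)] by simp
        with N[OF that] have "cmod (c i - c j) * infdist v M < e * infdist v M" by linarith
        with d show ?thesis by simp
      qed
      then show "\<exists>M. \<forall>m\<ge>M. \<forall>n\<ge>M. norm (c m - c n) < e" by blast
    qed
    then obtain c0 where c0: "c \<longlonglongrightarrow> c0" using Cauchy_convergent convergent_def by blast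
    have "(\<lambda>n. X n - c n *\<^sub>C v) \<longlonglongrightarrow> x - c0 *\<^sub>C v"
      by (intro tendsto_diff X(2) bounded_linear.tendsto[OF bounded_linear_scaleC_left] c0)
    moreover have "(\<lambda>n. X n - c n *\<^sub>C v) = m" by (simp add: mc(2))
    ultimately have "x - c0 *\<^sub>C v \<in> M" using closed_sequentially[OF M(1)] mc(1) by metis
    moreover have "x = (x - c0 *\<^sub>C v) + c0 *\<^sub>C v" by simp
    ultimately show "x \<in> {m + c *\<^sub>C v | m c. m \<in> M}" by blast
  qed
qed

lemma closed_subspace_add_span:
  fixes M :: "'a::complex_normed_vector set"
  assumes "finite B" and M: "closed M" "complex_vector.subspace M"
  shows "closed {m + w | m w. m \<in> M \<and> w \<in> complex_vector.span B}"
  using assms(1)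
proof (induction B)
  case (insert v B)
  let ?S = "{m + w | m w. m \<in> M \<and> w \<in> complex_vector.span B}"
  have "{m + w | m w. m \<in> M \<and> w \<in> complex_vector.span (insert v B)} = {s + c *\<^sub>C v | s c. s \<in> ?S}"
    (is "?L = ?R")
  proof (intro equalityI subsetI)
    fix x assume "x \<in> ?L"
    then obtain m w c where "m \<in> M" "w - c *\<^sub>C v \<in> complex_vector.span B" "x = m + w"
      by (auto simp: complex_vector.span_insert)
    moreover have "m + w = (m + (w - c *\<^sub>C v)) + c *\<^sub>C v" by simp
    ultimately show "x \<in> ?R" by blast
  next
    fix x assume "x \<in> ?R"
    then obtain m w c where x: "m \<in> M" "w \<in> complex_vector.span B" "x = (m + w) + c *\<^sub>C v" by blast
    then have "w + c *\<^sub>C v \<in> complex_vector.span (insert v B)" unfolding complex_vector.span_insert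
      by (auto intro!: exI[of _ c])
    with x show "x \<in> ?L" by (auto simp: add.assoc)
  qed
  moreover have "closed {s + c *\<^sub>C v | s c. s \<in> ?S}"
    using insert.IH M(2) by (intro closed_subspace_add_line complex_vector.subspace_sums) auto
  ultimately show ?case by simp
qed (simp add: M(1))

lemma fin_dim_imp_closed:
  fixes V :: "'a::complex_normed_vector set"
  assumes "fin_dim V"
  shows "closed V"
proof -
  obtain B where B: "finite B" "complex_vector.span B = V" using assms by (auto simp: fin_dim_def)
  from closed_subspace_add_span[OF B(1) closed_singleton complex_vector.subspace_single_0] B(2)
  show ?thesis by simp
qed

section \<open>Powers and shifts of an operator\<close>

lemma bounded_clinear_simps:
  assumes "bounded_clinear A"
  shows "A (x + y) = A x + A y" "A (x - y) = A x - A y" "A (- x) = - A x" "A 0 = 0"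
    "A (c *\<^sub>C x) = c *\<^sub>C A x"
  using assms linear_simps[of A] by (auto simp: bounded_clinear_def)

lemma bounded_clinear_compose:
  "bounded_clinear A \<Longrightarrow> bounded_clinear B \<Longrightarrow> bounded_clinear (\<lambda>x. A (B x))"
  by (auto simp: bounded_clinear_def bounded_linear_compose)

lemma bounded_clinear_funpow:
  fixes A :: "'a::complex_normed_vector \<Rightarrow> 'a"
  assumes "bounded_clinear A"
  shows "bounded_clinear (A ^^ n)"
proof (induction n)
  case 0
  show ?case by (simp add: bounded_clinear_def id_def bounded_linear_ident)
next
  case (Suc n)
  then show ?case using bounded_clinear_compose[OF assms Suc] by (simp add: comp_def)
qed

lemma bounded_linear_scaleC_right: "bounded_linear (\<lambda>x. c *\<^sub>C (x::'a::complex_normed_vector))"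
proof (rule bounded_linear_intro)
  show "c *\<^sub>C (r *\<^sub>R x) = r *\<^sub>R (c *\<^sub>C x)" for r and x :: 'a
    by (simp add: scaleC_scaleC mult.commute flip: scaleC_of_real)
  show "norm (c *\<^sub>C x) \<le> norm x * cmod c" for x :: 'a by (simp add: norm_scaleC)
qed (rule scaleC_add_right)

lemma bounded_clinear_shift: "bounded_clinear T \<Longrightarrow> bounded_clinear (shift T \<mu>)"
  unfolding bounded_clinear_def shift_def
  by (auto intro: bounded_linear_sub bounded_linear_scaleC_right
      simp: complex_vector.scale_right_diff_distrib scaleC_scaleC mult.commute)

lemma shift_shift: "shift (shift T a) b = shift T (a + b)"
  by (simp add: shift_def fun_eq_iff scaleC_add_left)

lemma shift_0 [simp]: "shift T 0 = T"
  by (simp add: shift_def)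

lemma subspace_range:
  assumes "bounded_clinear A"
  shows "complex_vector.subspace (range A)"
proof -
  interpret A: Vector_Spaces.linear scaleC scaleC A by (rule bounded_clinear_linear[OF assms])
  show ?thesis by (rule A.subspace_image[OF complex_vector.subspace_UNIV])
qed

lemma subspace_null_space:
  assumes "bounded_clinear A"
  shows "complex_vector.subspace (null_space A)"
proof -
  interpret A: Vector_Spaces.linear scaleC scaleC A by (rule bounded_clinear_linear[OF assms])
  show ?thesis unfolding null_space_def by (rule A.subspace_kernel)
qed

lemma shift_funpow_commute:
  assumes "bounded_clinear A"
  shows "shift A \<nu> ((A ^^ n) x) = (A ^^ n) (shift A \<nu> x)"
  using bounded_clinear_funpow[OF assms, of n]
  by (simp add: shift_def bounded_clinear_simps funpow_swap1)

lemma range_funpow_antimono: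
  fixes A :: "'a \<Rightarrow> 'a"
  shows "m \<le> n \<Longrightarrow> range (A ^^ n) \<subseteq> range (A ^^ m)"
proof -
  assume "m \<le> n"
  then have "(A ^^ n) x = (A ^^ m) ((A ^^ (n - m)) x)" for x
    by (metis add_diff_inverse_nat comp_apply funpow_add not_le)
  then show ?thesis by auto
qed

lemma null_space_funpow_mono: "bounded_clinear A \<Longrightarrow> m \<le> n \<Longrightarrow> null_space (A ^^ m) \<subseteq> null_space (A ^^ n)"
proof -
  assume A: "bounded_clinear A" and "m \<le> n"
  then have "(A ^^ n) x = (A ^^ (n - m)) ((A ^^ m) x)" for x
    by (metis comp_apply funpow_add le_add_diff_inverse2)
  then show ?thesis using bounded_clinear_funpow[OF A] by (auto simp: null_space_def bounded_clinear_simps)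
qed

lemma fin_dim_null_space_funpow:
  assumes A: "bounded_clinear A" and N: "fin_dim (null_space A)"
  shows "fin_dim (null_space (A ^^ n))"
proof (induction n)
  case 0
  have "complex_vector.span {} = null_space (A ^^ 0)" by (auto simp: null_space_def)
  then show ?case unfolding fin_dim_def by blast
next
  case (Suc n)
  have "null_space (A ^^ Suc n) = A -` null_space (A ^^ n)"
    by (auto simp: null_space_def funpow_swap1)
  with fin_dim_vimage[OF bounded_clinear_linear[OF A] N Suc] show ?case by (simp only:)
qed

lemma closed_image_of_closed_range:
  fixes A :: "'a::complex_banach \<Rightarrow> 'a"
  assumes A: "bounded_clinear A" and cl: "closed (range A)" and N: "fin_dim (null_space A)"
    and M: "closed M" "complex_vector.subspace M"
  shows "closed (A ` M)"
proof -
  note A_simps = bounded_clinear_simps[OF A]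
  obtain B where B: "finite B" "complex_vector.span B = null_space A" using N by (auto simp: fin_dim_def)
  define M' where "M' = {m + w | m w. m \<in> M \<and> w \<in> null_space A}"
  have M': "closed M'" using closed_subspace_add_span[OF B(1) M] B(2) by (simp add: M'_def)
  obtain C where C: "C > 0" "\<And>y. y \<in> range A \<Longrightarrow> \<exists>x. A x = y \<and> norm x \<le> C * norm y"
    using open_mapping_bound[OF bounded_clinear_bounded_linear[OF A] closed_UNIV subspace_UNIV cl] by auto
  show ?thesis unfolding closed_sequential_limits
  proof (intro allI impI, elim conjE)
    fix Y y assume Y: "\<forall>n. Y n \<in> A ` M" "Y \<longlonglongrightarrow> y"
    then have "\<forall>n. \<exists>m. m \<in> M \<and> Y n = A m" by blast
    then obtain m where m: "\<And>n. m n \<in> M" "\<And>n. Y n = A (m n)" by metis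
    have "y \<in> range A" using closed_sequentially[OF cl _ Y(2)] m(2) by auto
    then obtain x where x: "y = A x" by blast
    have "Y n - y = A (m n - x)" for n using m(2) x A_simps(2) by simp
    then have "Y n - y \<in> range A" for n by simp
    then have "\<forall>n. \<exists>z. A z = Y n - y \<and> norm z \<le> C * norm (Y n - y)" using C(2) by blast
    then obtain z where z: "\<And>n. A (z n) = Y n - y" "\<And>n. norm (z n) \<le> C * norm (Y n - y)"
      by metis
    have "(\<lambda>n. norm (Y n - y)) \<longlonglongrightarrow> 0"
      by (rule tendsto_norm_zero[OF LIM_zero[OF Y(2)]])
    then have "(\<lambda>n. C * norm (Y n - y)) \<longlonglongrightarrow> 0" by (rule tendsto_mult_right_zero)
    then have "z \<longlonglongrightarrow> 0" using z(2) by (intro Lim_null_comparison[where f = z]) auto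
    then have lim: "(\<lambda>n. x + z n) \<longlonglongrightarrow> x" using tendsto_add[OF tendsto_const[of x]] by fastforce
    have "x + z n \<in> M'" for n
    proof -
      have "A (x + z n - m n) = 0" using z(1) m(2) x A_simps by simp
      then have "m n + (x + z n - m n) \<in> M'" unfolding M'_def null_space_def using m(1) by blast
      then show ?thesis by simp
    qed
    then have "x \<in> M'" using closed_sequentially[OF M' _ lim] by blast
    then show "y \<in> A ` M" using x A_simps by (auto simp: M'_def null_space_def)
  qed
qed

lemma closed_range_funpow:
  fixes A :: "'a::complex_banach \<Rightarrow> 'a"
  assumes A: "bounded_clinear A" and cl: "closed (range A)" and N: "fin_dim (null_space A)"
  shows "closed (range (A ^^ n))"
proof (induction n)
  case (Suc n)
  have "range (A ^^ Suc n) = A ` range (A ^^ n)" by auto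
  with closed_image_of_closed_range[OF A cl N Suc subspace_range[OF bounded_clinear_funpow[OF A]]]
  show ?case by simp
qed simp

text \<open>Bounded inverse theorem: boundedness of the algebraic inverse comes from the open
  mapping bound.\<close>

lemma bij_shift_iff_notin_spectrum:
  fixes T :: "'a::complex_banach \<Rightarrow> 'a"
  assumes T: "bounded_clinear T"
  shows "\<mu> \<notin> op_spectrum T \<longleftrightarrow> bij (shift T \<mu>)"
proof
  assume "\<mu> \<notin> op_spectrum T"
  then show "bij (shift T \<mu>)" unfolding op_spectrum_def using o_bij by blast
next
  assume bij: "bij (shift T \<mu>)"
  define A where "A = shift T \<mu>"
  have A: "bounded_clinear A" unfolding A_def using T by (rule bounded_clinear_shift)
  have inv: "inv A (A x) = x" "A (inv A x) = x" for x
    using bij unfolding A_def[symmetric] by (simp_all add: bij_is_inj bij_is_surj surj_f_inv_f)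
  have surj: "range A = UNIV" using inv(2) by (metis surjI)
  obtain C where C: "C > 0" "\<And>y. y \<in> range A \<Longrightarrow> \<exists>x\<in>UNIV. A x = y \<and> norm x \<le> C * norm y"
    by (rule open_mapping_bound[OF bounded_clinear_bounded_linear[OF A] closed_UNIV subspace_UNIV])
      (simp_all add: surj)
  have "bounded_clinear (inv A)" unfolding bounded_clinear_def
  proof (intro conjI allI)
    have sc: "inv A (c *\<^sub>C x) = c *\<^sub>C inv A x" for c x
      using bounded_clinear_simps(5)[OF A] inv by metis
    then show "inv A (c *\<^sub>C x) = c *\<^sub>C inv A x" for c x .
    show "bounded_linear (inv A)"
    proof (rule bounded_linear_intro)
      show "inv A (x + y) = inv A x + inv A y" for x y
        using bounded_clinear_simps(1)[OF A] inv by metis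
      show "inv A (r *\<^sub>R x) = r *\<^sub>R inv A x" for r x using sc[of "of_real r"] by (simp add: scaleC_of_real)
      show "norm (inv A x) \<le> norm x * C" for x using C(2)[of x] inv(1) surj by (metis UNIV_I mult.commute)
    qed
  qed
  moreover have "inv A \<circ> A = id" "A \<circ> inv A = id" using inv by (auto simp: fun_eq_iff)
  ultimately show "\<mu> \<notin> op_spectrum T" unfolding op_spectrum_def A_def by blast
qed

section \<open>The single valued extension property at a semi-Fredholm point\<close>

lemma SVEP_shift:
  assumes "SVEP T"
  shows "SVEP (shift T a)"
  unfolding SVEP_def
proof (intro allI impI ballI)
  fix U :: "complex set" and f \<mu>
  assume U: "open U" "f vanalytic_on U" "\<forall>\<mu>\<in>U. shift (shift T a) \<mu> (f \<mu>) = 0" and \<mu>: "\<mu> \<in> U"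
  define V where "V = (\<lambda>z. z - a) -` U"
  have "open V" unfolding V_def by (intro open_vimage U(1) continuous_intros)
  moreover have "(\<lambda>z. f (z - a)) vanalytic_on V" unfolding vanalytic_on_def
  proof
    fix z assume "z \<in> V"
    then obtain D where "(f has_derivative (\<lambda>h. h *\<^sub>C D)) (at (z - a))"
      using U(2) by (auto simp: V_def vanalytic_on_def)
    moreover have "((\<lambda>z. z - a) has_derivative (\<lambda>h. h)) (at z)"
      by (auto intro!: derivative_eq_intros)
    ultimately have "((\<lambda>z. f (z - a)) has_derivative (\<lambda>h. h *\<^sub>C D)) (at z)"
      using has_derivative_compose[of "\<lambda>z. z - a" "\<lambda>h. h" z UNIV f] by simp
    then show "\<exists>D. ((\<lambda>z. f (z - a)) has_derivative (\<lambda>h. h *\<^sub>C D)) (at z)" by blast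
  qed
  moreover have "shift T z (f (z - a)) = 0" if "z \<in> V" for z
    using U(3) that by (auto simp: V_def shift_shift)
  ultimately have "f ((\<mu> + a) - a) = 0"
    using assms[unfolded SVEP_def, rule_format, of V "\<lambda>z. f (z - a)" "\<mu> + a"] \<mu> by (simp add: V_def)
  then show "f \<mu> = 0" by simp
qed

text \<open>The remainder of \<open>z ^ n\<close> at first order is at most
  \<open>n * (n - 1) * r ^ (n - 2)\<close> times the square of the increment while both points stay
  within radius \<open>r\<close>. For \<open>r < 1 / C\<close> these bounds remain summable after
  multiplication by \<open>K * C ^ n\<close>.\<close>

lemma power_series_vanalytic:
  fixes a :: "nat \<Rightarrow> 'a::complex_banach"
  assumes C: "C > 0" and a: "\<And>n. norm (a n) \<le> K * C ^ n"
  shows "(\<lambda>z. \<Sum>n. z ^ n *\<^sub>C a n) vanalytic_on ball 0 (1 / C)"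
    and "\<And>z. z \<in> ball 0 (1 / C) \<Longrightarrow> summable (\<lambda>n. z ^ n *\<^sub>C a n)"
proof -
  \<comment> \<open>\<open>diffs (\<lambda>_. 1)\<close> is the sequence \<open>n + 1\<close>, and a
    second \<open>diffs\<close> gives \<open>(n + 1) * (n + 2)\<close>: the coefficients of the
    first two derivatives of the geometric series, which dominate the differentiated series after an
    index shift.\<close>
  have dsum: "summable (\<lambda>n. diffs (\<lambda>_. 1) n * x ^ n)" if "norm x < 1" for x :: real
    by (rule termdiff_converges[where K = 1]) (use that in \<open>auto intro: summable_geometric\<close>)
  have ddsum: "summable (\<lambda>n. diffs (diffs (\<lambda>_. 1)) n * x ^ n)" if "norm x < 1" for x :: real
    by (rule termdiff_converges[where K = 1]) (use that dsum in auto)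
  have sum0: "summable (\<lambda>n. z ^ n *\<^sub>C a n)" if z: "norm z * C < 1" for z
  proof (rule summable_comparison_test')
    show "summable (\<lambda>n. K * (norm z * C) ^ n)"
      using z C by (intro summable_mult summable_geometric) (simp add: abs_mult)
    show "norm (z ^ n *\<^sub>C a n) \<le> K * (norm z * C) ^ n" for n
      using mult_left_mono[OF a[of n], of "norm z ^ n"]
      by (simp add: norm_scaleC norm_power power_mult_distrib mult_ac)
  qed
  have sum1: "summable (\<lambda>n. (of_nat n * z ^ (n - 1)) *\<^sub>C a n)" if z: "norm z * C < 1" for z
  proof (subst summable_Suc_iff[symmetric], rule summable_comparison_test')
    show "summable (\<lambda>n. K * C * (diffs (\<lambda>_. 1) n * (norm z * C) ^ n))"
      using z C by (intro summable_mult dsum) (simp add: abs_mult)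
    show "norm ((of_nat (Suc n) * z ^ (Suc n - 1)) *\<^sub>C a (Suc n)) \<le>
        K * C * (diffs (\<lambda>_. 1) n * (norm z * C) ^ n)" for n
      using mult_left_mono[OF a[of "Suc n"], of "real (Suc n) * norm z ^ n"]
      by (simp add: norm_scaleC norm_mult norm_power power_mult_distrib diffs_def mult_ac del: of_nat_Suc)
  qed
  have sum2: "summable (\<lambda>n. real n * real (n - Suc 0) * r ^ (n - 2) * (K * C ^ n))"
    if r: "0 \<le> r" "r * C < 1" for r
  proof (subst summable_iff_shift[of _ 2, symmetric])
    have "summable (\<lambda>n. K * C\<^sup>2 * (diffs (diffs (\<lambda>_. 1)) n * (r * C) ^ n))"
      using r C by (intro summable_mult ddsum) (simp add: abs_mult)
    then show "summable (\<lambda>n. real (n + 2) * real (n + 2 - Suc 0) * r ^ (n + 2 - 2) * (K * C ^ (n + 2)))"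
      by (simp add: diffs_def power_mult_distrib power_add mult_ac power2_eq_square)
  qed
  show "summable (\<lambda>n. z ^ n *\<^sub>C a n)" if "z \<in> ball 0 (1 / C)" for z
    using that C by (intro sum0) (simp add: field_simps)
  show "(\<lambda>z. \<Sum>n. z ^ n *\<^sub>C a n) vanalytic_on ball 0 (1 / C)"
    unfolding vanalytic_on_def
  proof
    fix z :: complex assume z: "z \<in> ball 0 (1 / C)"
    obtain r where r: "norm z < r" "r < 1 / C" using z dense[of "norm z" "1 / C"] by auto
    have r': "0 \<le> r" "r * C < 1" using r C norm_ge_zero[of z] by (linarith, simp add: field_simps)
    define L where "L = (\<Sum>n. real n * real (n - Suc 0) * r ^ (n - 2) * (K * C ^ n))"
    define D where "D = (\<Sum>n. (of_nat n * z ^ (n - 1)) *\<^sub>C a n)"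
    have zC: "norm z * C < 1" if "norm z < r" for z :: complex
      using that r'(2) C by (meson mult_strict_right_mono order_less_trans)
    have "((\<lambda>z. \<Sum>n. z ^ n *\<^sub>C a n) has_derivative (\<lambda>h. h *\<^sub>C D)) (at z)"
    proof (rule has_derivative_quadratic_remainder)
      show "r - norm z > 0" using r by simp
      fix w assume "dist w z < r - norm z"
      then have w: "norm w < r" using norm_triangle_ineq2[of w z] by (simp add: dist_norm)
      define t where "t n = w ^ n - z ^ n - (w - z) * (of_nat n * z ^ (n - 1))" for n
      have t: "norm (t n) \<le> real n * real (n - Suc 0) * r ^ (n - 2) * (norm (w - z))\<^sup>2" for n
      proof (cases "w = z")
        case False
        then have "t n = (w - z) * (((z + (w - z)) ^ n - z ^ n) / (w - z) - of_nat n * z ^ (n - Suc 0))"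
          by (simp add: t_def field_simps)
        then have "norm (t n) =
            norm (w - z) * norm (((z + (w - z)) ^ n - z ^ n) / (w - z) - of_nat n * z ^ (n - Suc 0))"
          by (simp only: norm_mult)
        also have "\<dots> \<le> norm (w - z) * (of_nat n * of_nat (n - Suc 0) * r ^ (n - 2) * norm (w - z))"
          using False w r by (intro mult_left_mono lemma_termdiff3) auto
        finally show ?thesis by (simp add: power2_eq_square mult_ac)
      qed (simp add: t_def)
      have s: "summable (\<lambda>n. real n * real (n - Suc 0) * r ^ (n - 2) * (K * C ^ n) * (norm (w - z))\<^sup>2)"
        by (intro summable_mult2 sum2 r')
      have ta: "norm (t n *\<^sub>C a n) \<le> real n * real (n - Suc 0) * r ^ (n - 2) * (K * C ^ n) * (norm (w - z))\<^sup>2" for n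
      proof -
        have "norm (t n *\<^sub>C a n) \<le> (real n * real (n - Suc 0) * r ^ (n - 2) * (norm (w - z))\<^sup>2) * (K * C ^ n)"
          unfolding norm_scaleC using r' by (intro mult_mono t a) auto
        then show ?thesis by (simp add: mult_ac)
      qed
      have "(\<Sum>n. w ^ n *\<^sub>C a n) - (\<Sum>n. z ^ n *\<^sub>C a n) - (w - z) *\<^sub>C D = (\<Sum>n. t n *\<^sub>C a n)"
      proof -
        have 1: "(\<lambda>n. w ^ n *\<^sub>C a n) sums (\<Sum>n. w ^ n *\<^sub>C a n)" "(\<lambda>n. z ^ n *\<^sub>C a n) sums (\<Sum>n. z ^ n *\<^sub>C a n)"
          using sum0[OF zC] w r(1) by (auto intro: summable_sums)
        have 2: "(\<lambda>n. (w - z) *\<^sub>C ((of_nat n * z ^ (n - 1)) *\<^sub>C a n)) sums ((w - z) *\<^sub>C D)"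
          unfolding D_def
          by (intro bounded_linear.sums[OF bounded_linear_scaleC_right] summable_sums sum1 zC r(1))
        from sums_diff[OF sums_diff[OF 1] 2] show ?thesis
          by (simp add: t_def complex_vector.scale_left_diff_distrib scaleC_scaleC sums_iff)
      qed
      also have "norm \<dots> \<le> (\<Sum>n. norm (t n *\<^sub>C a n))"
        by (intro summable_norm summable_comparison_test'[OF s, of 0]) (use ta in auto)
      also have "\<dots> \<le> (\<Sum>n. real n * real (n - Suc 0) * r ^ (n - 2) * (K * C ^ n) * (norm (w - z))\<^sup>2)"
        by (intro suminf_le ta s summable_comparison_test'[OF s, of 0]) (use ta in auto)
      also have "\<dots> = L * (norm (w - z))\<^sup>2"
        unfolding L_def by (rule suminf_mult2[symmetric]) (rule sum2[OF r'])
      finally show "norm ((\<Sum>n. w ^ n *\<^sub>C a n) - (\<Sum>n. z ^ n *\<^sub>C a n) - (w - z) *\<^sub>C D) \<le> L * (norm (w - z))\<^sup>2" .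
    qed
    then show "\<exists>D. ((\<lambda>z. \<Sum>n. z ^ n *\<^sub>C a n) has_derivative (\<lambda>h. h *\<^sub>C D)) (at z)" by blast
  qed
qed

text \<open>A backward orbit \<open>x 0\<close>, \<open>x 1\<close>, ... of a kernel vector that grows at most geometrically makes
  \<open>\<Sum>n. z ^ n *\<^sub>C x n\<close> an analytic family of eigenvectors.\<close>

lemma SVEP_backward_orbit_zero:
  fixes A :: "'a::complex_banach \<Rightarrow> 'a"
  assumes A: "bounded_clinear A" and S: "SVEP A"
    and x: "A (x 0) = 0" "\<And>n. A (x (Suc n)) = x n"
    and C: "C > 0" "\<And>n. norm (x n) \<le> K * C ^ n"
  shows "x 0 = 0"
proof -
  define f where "f z = (\<Sum>n. z ^ n *\<^sub>C x n)" for z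
  have "shift A z (f z) = 0" if z: "z \<in> ball 0 (1 / C)" for z
  proof -
    have s: "summable (\<lambda>n. z ^ n *\<^sub>C x n)" by (rule power_series_vanalytic(2)[OF C z])
    have sA: "summable (\<lambda>n. A (z ^ n *\<^sub>C x n))"
      by (rule bounded_linear.summable[OF bounded_clinear_bounded_linear[OF A] s])
    have "A (f z) = (\<Sum>n. A (z ^ n *\<^sub>C x n))"
      unfolding f_def by (rule bounded_linear.suminf[OF bounded_clinear_bounded_linear[OF A] s])
    \<comment> \<open>\<open>A\<close> kills the head \<open>x 0\<close> and moves every other term
      one place down, which leaves a factor \<open>z\<close>.\<close>
    also have "\<dots> = (\<Sum>n. A (z ^ Suc n *\<^sub>C x (Suc n))) + A (z ^ 0 *\<^sub>C x 0)"
      using suminf_split_head[OF sA] by simp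
    also have "\<dots> = (\<Sum>n. z *\<^sub>C (z ^ n *\<^sub>C x n))"
      using bounded_clinear_simps[OF A] x by (simp add: scaleC_scaleC)
    also have "\<dots> = z *\<^sub>C f z"
      unfolding f_def by (rule bounded_linear.suminf[OF bounded_linear_scaleC_right s, symmetric])
    finally show ?thesis by (simp add: shift_def)
  qed
  moreover have "f vanalytic_on ball 0 (1 / C)"
    unfolding f_def by (rule power_series_vanalytic(1)[OF C])
  ultimately have "f 0 = 0"
    using S[unfolded SVEP_def, rule_format, of "ball 0 (1 / C)" f 0] C(1) by simp
  moreover have "f 0 = x 0"
  proof -
    have "summable (\<lambda>n. 0 ^ n *\<^sub>C x n)" by (rule power_series_vanalytic(2)[OF C]) (use C in simp)
    from suminf_split_head[OF this] show ?thesis by (simp add: f_def)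
  qed
  ultimately show ?thesis by simp
qed

text \<open>The spaces \<open>V n\<close> decrease inside the finite dimensional kernel, and their
  stable value \<open>V p\<close> lies in the intersection \<open>H\<close> of all ranges.
  Stabilisation is also what makes \<open>A\<close> map \<open>H\<close> onto itself. As
  \<open>H\<close> is closed, preimages in \<open>H\<close> can be chosen with a uniform bound
  \<open>C\<close>; iterating the choice \<open>g\<close> gives the backward orbit of growth
  \<open>C ^ n\<close>.\<close>

lemma SVEP_kernel_range_trivial:
  fixes A :: "'a::complex_banach \<Rightarrow> 'a"
  assumes A: "bounded_clinear A" and S: "SVEP A"
    and cl: "closed (range A)" and N: "fin_dim (null_space A)"
  obtains p where "p > 0" "null_space A \<inter> range (A ^^ p) \<subseteq> {0}"
proof -
  note A_simps = bounded_clinear_simps[OF A]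
  define H where "H = (\<Inter>n. range (A ^^ n))"
  have subR: "complex_vector.subspace (range (A ^^ n))" for n
    by (rule subspace_range[OF bounded_clinear_funpow[OF A]])
  have H: "closed H" "complex_vector.subspace H"
    unfolding H_def using closed_range_funpow[OF A cl N] subR
    by (auto intro!: complex_vector.subspace_Inter)
  define V where "V n = null_space A \<inter> range (A ^^ n)" for n
  obtain p where p: "\<And>n. n \<ge> p \<Longrightarrow> V n = V p"
  proof (rule decreasing_subspaces_stabilize[OF N])
    show "complex_vector.subspace (V n)" for n
      unfolding V_def by (intro complex_vector.subspace_inter subspace_null_space A subR)
    show "decseq V" unfolding decseq_def V_def using range_funpow_antimono[of _ _ A] by blast
  qed (auto simp: V_def)
  have VH: "x \<in> H" if "x \<in> V p" for x
  proof -
    have "x \<in> range (A ^^ n)" for n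
    proof -
      have "x \<in> V (max n p)" using p[of "max n p"] that by simp
      then show ?thesis using range_funpow_antimono[of n "max n p" A] by (auto simp: V_def)
    qed
    then show ?thesis by (auto simp: H_def)
  qed
  have AH: "A ` H = H"
  proof
    show "A ` H \<subseteq> H"
    proof
      fix y assume "y \<in> A ` H"
      then obtain x where x: "x \<in> H" "y = A x" by blast
      have "A x \<in> range (A ^^ n)" for n
      proof -
        obtain u where "x = (A ^^ n) u" using x(1) by (auto simp: H_def)
        then have "A x = (A ^^ n) (A u)" by (simp add: funpow_swap1)
        then show ?thesis by blast
      qed
      then show "y \<in> H" using x(2) by (auto simp: H_def)
    qed
    show "H \<subseteq> A ` H"
    proof
      fix y assume y: "y \<in> H"
      have ex: "\<exists>x\<in>range (A ^^ n). y = A x" for n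
      proof -
        have "y \<in> range (A ^^ Suc n)" using y unfolding H_def by blast
        then show ?thesis by auto
      qed
      \<comment> \<open>One preimage \<open>x\<close> in the range of \<open>A ^^ p\<close> is
        fixed. For \<open>n \<ge> p\<close> it differs from a preimage in the range of
        \<open>A ^^ n\<close> by an element of \<open>V p = V n\<close>, so \<open>x\<close> itself
        lies in every range.\<close>
      obtain x where x: "x \<in> range (A ^^ p)" "y = A x" using ex by blast
      have "x \<in> range (A ^^ n)" if n: "n \<ge> p" for n
      proof -
        obtain u where u: "u \<in> range (A ^^ n)" "y = A u" using ex by blast
        have "x - u \<in> range (A ^^ p)"
          using x(1) u(1) range_funpow_antimono[OF n, of A]
          by (intro complex_vector.subspace_diff[OF subR]) auto
        then have "x - u \<in> V p" using x(2) u(2) A_simps by (simp add: V_def null_space_def)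
        then have "x - u \<in> range (A ^^ n)" using p[OF n] by (auto simp: V_def)
        from complex_vector.subspace_add[OF subR u(1) this] show ?thesis by simp
      qed
      then have "x \<in> range (A ^^ n)" for n
        using range_funpow_antimono[of n "max n p" A] by (meson max.cobounded1 max.cobounded2 subsetD)
      then have "x \<in> H" by (auto simp: H_def)
      with x show "y \<in> A ` H" by blast
    qed
  qed
  have "closed (A ` H)" using H(1) AH by simp
  then obtain C where C: "C > 0" "\<And>y. y \<in> H \<Longrightarrow> \<exists>x\<in>H. A x = y \<and> norm x \<le> C * norm y"
    using open_mapping_bound[OF bounded_clinear_bounded_linear[OF A] H(1) csubspace_imp_subspace[OF H(2)]]
    unfolding AH by blast
  then obtain g where g: "\<And>y. y \<in> H \<Longrightarrow> g y \<in> H \<and> A (g y) = y \<and> norm (g y) \<le> C * norm y" by metis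
  have "V p \<subseteq> {0}"
  proof
    fix x0 assume x0: "x0 \<in> V p"
    define x where "x n = (g ^^ n) x0" for n
    have xH: "x n \<in> H" for n by (induction n) (use VH[OF x0] g in \<open>auto simp: x_def\<close>)
    have "x 0 = 0"
    proof (rule SVEP_backward_orbit_zero[OF A S _ _ C(1)])
      show "A (x 0) = 0" using x0 by (simp add: x_def V_def null_space_def)
      show "A (x (Suc n)) = x n" for n using g[OF xH[of n]] by (simp add: x_def)
      show "norm (x n) \<le> norm x0 * C ^ n" for n
      proof (induction n)
        case (Suc n)
        have "norm (x (Suc n)) \<le> C * norm (x n)" using g[OF xH[of n]] by (simp add: x_def)
        also have "\<dots> \<le> C * (norm x0 * C ^ n)" using Suc C(1) by (intro mult_left_mono) auto
        finally show ?case by (simp add: mult_ac)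
      qed (simp add: x_def)
    qed
    then show "x0 \<in> {0}" by (simp add: x_def)
  qed
  \<comment> \<open>Passing to \<open>Suc p\<close> makes the exponent positive, so that the kernel
    of the power contains the kernel of \<open>A\<close>.\<close>
  moreover have "V (Suc p) = V p" by (rule p) simp
  ultimately show thesis by (intro that[of "Suc p"]) (simp_all only: V_def zero_less_Suc)
qed

text \<open>\<open>A\<close> is injective on the closed space \<open>M = R(A^p)\<close> with closed
  image, hence bounded below there. If \<open>A x\<close> lies in N(A^p), then A^p x lies in N(A)
  \<inter> R(A^p) and vanishes, which is the condition on \<open>K\<close> in the count. Both facts
  are delivered for the same \<open>p\<close>, since the kernel and the range of one power are used
  together later.\<close>

lemma SVEP_bounded_below_on_range:
  fixes A :: "'a::complex_banach \<Rightarrow> 'a"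
  assumes A: "bounded_clinear A" and S: "SVEP A"
    and cl: "closed (range A)" and N: "fin_dim (null_space A)"
  obtains p c where "c > 0" "\<And>x. x \<in> range (A ^^ p) \<Longrightarrow> c * norm x \<le> norm (A x)"
    "weyl A \<longleftrightarrow> (\<forall>x. \<exists>k\<in>null_space (A ^^ p). x - k \<in> range A)"
proof -
  note A_simps = bounded_clinear_simps[OF A]
  obtain p where p: "p > 0" "null_space A \<inter> range (A ^^ p) \<subseteq> {0}"
    by (rule SVEP_kernel_range_trivial[OF A S cl N])
  define M where "M = range (A ^^ p)"
  have M: "closed M" "complex_vector.subspace M" unfolding M_def
    by (rule closed_range_funpow[OF A cl N], rule subspace_range[OF bounded_clinear_funpow[OF A]])
  obtain C where C: "C > 0" "\<And>y. y \<in> A ` M \<Longrightarrow> \<exists>x\<in>M. A x = y \<and> norm x \<le> C * norm y"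
    using open_mapping_bound[OF bounded_clinear_bounded_linear[OF A] M(1) csubspace_imp_subspace[OF M(2)]
        closed_image_of_closed_range[OF A cl N M]] by blast
  show thesis
  proof (rule that[of "1 / C" p])
    show "1 / C > 0" using C by simp
    show "1 / C * norm x \<le> norm (A x)" if x: "x \<in> range (A ^^ p)" for x
    proof -
      obtain x' where x': "x' \<in> M" "A x' = A x" "norm x' \<le> C * norm (A x)"
        using C(2)[of "A x"] x by (auto simp: M_def)
      have "x' - x \<in> null_space A \<inter> M"
        using x x' complex_vector.subspace_diff[OF M(2)] A_simps by (auto simp: M_def null_space_def)
      then have "x' = x" using p(2) by (auto simp: M_def)
      with x'(3) C(1) show ?thesis by (simp add: field_simps)
    qed
    let ?K = "null_space (A ^^ p)"
    have "?K \<inter> range A \<subseteq> A ` ?K"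
    proof
      fix y assume y: "y \<in> ?K \<inter> range A"
      then obtain x where x: "y = A x" by blast
      have "A ((A ^^ p) x) = 0" using y x by (simp add: null_space_def funpow_swap1)
      then have "(A ^^ p) x \<in> null_space A \<inter> range (A ^^ p)" by (simp add: null_space_def)
      then have "x \<in> ?K" using p(2) by (auto simp: null_space_def)
      with x show "y \<in> A ` ?K" by blast
    qed
    moreover have "A ` ?K \<subseteq> ?K" using A_simps by (auto simp: null_space_def simp flip: funpow_swap1)
    moreover have "null_space A \<subseteq> ?K" using null_space_funpow_mono[OF A, of 1 p] p(1) by simp
    ultimately show "weyl A \<longleftrightarrow> (\<forall>x. \<exists>k\<in>?K. x - k \<in> range A)"
      by (intro weyl_iff_fin_dim_sum A cl fin_dim_null_space_funpow N)
  qed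
qed

text \<open>Applying A^p to X = N(A^p) + R(A) shows that A maps R(A^p) onto itself, and so does A^p.
  Hence A^p x = A^p m for some m in R(A^p), and x - m is the component in the kernel.\<close>

lemma kernel_range_sum_decomposition:
  assumes A: "bounded_clinear A" and sum: "\<forall>x. \<exists>k\<in>null_space (A ^^ p). x - k \<in> range A"
  shows "A ` range (A ^^ p) = range (A ^^ p)"
    and "\<exists>k\<in>null_space (A ^^ p). x - k \<in> range (A ^^ p)"
proof -
  note P_simps = bounded_clinear_simps[OF bounded_clinear_funpow[OF A, of p]]
  show AM: "A ` range (A ^^ p) = range (A ^^ p)"
  proof (intro equalityI subsetI)
    fix y assume "y \<in> range (A ^^ p)"
    then obtain u where u: "y = (A ^^ p) u" by blast
    obtain k z where k: "k \<in> null_space (A ^^ p)" "u - k = A z" using sum by blast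
    have "(A ^^ p) u = (A ^^ p) (u - k)" using k(1) by (simp add: P_simps null_space_def)
    also have "\<dots> = A ((A ^^ p) z)" by (simp add: k(2) funpow_swap1)
    finally show "y \<in> A ` range (A ^^ p)" using u by blast
  qed (auto simp: funpow_swap1)
  have "(A ^^ n) ` range (A ^^ p) = range (A ^^ p)" for n
  proof (induction n)
    case (Suc n)
    have "(A ^^ Suc n) ` range (A ^^ p) = A ` (A ^^ n) ` range (A ^^ p)" by (simp add: image_comp)
    then show ?case using Suc AM by simp
  qed simp
  then have "(A ^^ p) x \<in> (A ^^ p) ` range (A ^^ p)" by simp
  then obtain m where m: "m \<in> range (A ^^ p)" "(A ^^ p) x = (A ^^ p) m" by blast
  have "x - m \<in> null_space (A ^^ p)" using m(2) by (simp add: null_space_def P_simps)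
  moreover have "x - (x - m) \<in> range (A ^^ p)" using m(1) by simp
  ultimately show "\<exists>k\<in>null_space (A ^^ p). x - k \<in> range (A ^^ p)" by blast
qed

lemma shift_range_funpow_subset:
  assumes "bounded_clinear A"
  shows "shift A \<nu> ` range (A ^^ p) \<subseteq> range (A ^^ p)"
  using shift_funpow_commute[OF assms] by auto

text \<open>On \<open>M\<close> the solutions for the parameter \<open>\<mu>\<close> are bounded
  with constant \<open>1 / c\<close>, so moving the parameter by at most \<open>c / 2\<close> gives
  relative error 1/2. It is applied from 0 to a nearby point and from a nearby point back to
  0.\<close>

lemma shift_onto_invariant:
  fixes A :: "'a::complex_banach \<Rightarrow> 'a"
  assumes A: "bounded_clinear A"
    and M: "closed M" "complex_vector.subspace M" "shift A \<nu> ` M \<subseteq> M" "shift A \<mu> ` M = M"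
    and c: "c > 0" "\<And>x. x \<in> M \<Longrightarrow> c * norm x \<le> norm (shift A \<mu> x)" and \<nu>: "norm (\<nu> - \<mu>) \<le> c / 2"
  shows "shift A \<nu> ` M = M"
proof (rule surjective_perturb[where A = "shift A \<mu>" and C = "1 / c" and e = "norm (\<nu> - \<mu>)"])
  show "\<exists>x\<in>M. shift A \<mu> x = y \<and> norm x \<le> 1 / c * norm y" if "y \<in> M" for y
  proof -
    have "y \<in> shift A \<mu> ` M" using that M(4) by simp
    then obtain x where x: "x \<in> M" "shift A \<mu> x = y" by blast
    have "norm x \<le> 1 / c * norm y" using c(2)[OF x(1)] x(2) c(1) by (simp add: field_simps)
    with x show ?thesis by blast
  qed
  show "norm (shift A \<mu> x - shift A \<nu> x) \<le> norm (\<nu> - \<mu>) * norm x" for x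
    by (simp add: shift_def norm_scaleC flip: complex_vector.scale_left_diff_distrib)
  show "norm (\<nu> - \<mu>) * (1 / c) \<le> 1 / 2" using \<nu> c(1) by (simp add: field_simps)
qed (use M c bounded_clinear_bounded_linear[OF bounded_clinear_shift[OF A]] csubspace_imp_subspace[OF M(2)] in auto)

text \<open>An eigenvector for \<open>\<nu> \<noteq> 0\<close> lies in R(A^p), where the lower bound
  \<open>c\<close> excludes eigenvalues of modulus below \<open>c\<close>. For surjectivity the two
  summands of X = N(A^p) + R(A^p) are treated separately: the second by perturbation, the first
  because A is nilpotent there.\<close>

lemma weyl_imp_punctured_bij:
  fixes A :: "'a::complex_banach \<Rightarrow> 'a"
  assumes A: "bounded_clinear A" and S: "SVEP A" and w: "weyl A"
  obtains e where "e > 0" "\<And>\<nu>. \<nu> \<noteq> 0 \<Longrightarrow> norm \<nu> < e \<Longrightarrow> bij (shift A \<nu>)"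
proof -
  note A_simps = bounded_clinear_simps[OF A]
  have cl: "closed (range A)" and N: "fin_dim (null_space A)"
    using w by (auto simp: weyl_def fredholm_def nullity_def cdim_def split: if_splits)
  obtain p c where c: "c > 0" "\<And>x. x \<in> range (A ^^ p) \<Longrightarrow> c * norm x \<le> norm (A x)"
    "weyl A \<longleftrightarrow> (\<forall>x. \<exists>k\<in>null_space (A ^^ p). x - k \<in> range A)"
    by (rule SVEP_bounded_below_on_range[OF A S cl N]) blast
  note dec = kernel_range_sum_decomposition[OF A c(3)[THEN iffD1, OF w]]
  have M: "closed (range (A ^^ p))" "complex_vector.subspace (range (A ^^ p))"
    by (rule closed_range_funpow[OF A cl N], rule subspace_range[OF bounded_clinear_funpow[OF A]])
  show thesis
  proof (rule that[of "c / 2"])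
    fix \<nu> :: complex assume \<nu>: "\<nu> \<noteq> 0" "norm \<nu> < c / 2"
    note B = bounded_clinear_shift[OF A, of \<nu>]
    have "x = 0" if x: "shift A \<nu> x = 0" for x
    proof -
      have Ax: "A x = \<nu> *\<^sub>C x" using x by (simp add: shift_def)
      have "(A ^^ n) x = \<nu> ^ n *\<^sub>C x" for n
        by (induction n) (simp_all add: A_simps Ax scaleC_scaleC mult.commute)
      then have "(A ^^ p) (inverse (\<nu> ^ p) *\<^sub>C x) = x"
        using \<nu>(1) bounded_clinear_simps(5)[OF bounded_clinear_funpow[OF A]] by (simp add: scaleC_scaleC)
      then have "x \<in> range (A ^^ p)" by (metis rangeI)
      from c(2)[OF this] have "c * norm x \<le> norm \<nu> * norm x" by (simp add: Ax norm_scaleC)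
      with \<nu>(2) c(1) show "x = 0" by (simp add: mult_le_cancel_right)
    qed
    then have inj: "inj (shift A \<nu>)"
      using bounded_clinear_simps(2)[OF B] by (metis (no_types, lifting) eq_iff_diff_eq_0 injI)
    have "shift A \<nu> ` range (A ^^ p) = range (A ^^ p)"
    proof (rule shift_onto_invariant[OF A M shift_range_funpow_subset[OF A] _ c(1)])
      show "shift A 0 ` range (A ^^ p) = range (A ^^ p)" unfolding shift_0 by (rule dec(1))
      show "c * norm x \<le> norm (shift A 0 x)" if "x \<in> range (A ^^ p)" for x
        unfolding shift_0 using that by (rule c(2))
      show "norm (\<nu> - 0) \<le> c / 2" using \<nu>(2) by simp
    qed
    then have Mr: "range (A ^^ p) \<subseteq> range (shift A \<nu>)" by blast
    have Kr: "null_space (A ^^ n) \<subseteq> range (shift A \<nu>)" for n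
    proof (induction n)
      case 0
      then show ?case using complex_vector.subspace_0[OF subspace_range[OF B]] by (auto simp: null_space_def)
    next
      case (Suc n)
      show ?case
      proof
        fix v assume "v \<in> null_space (A ^^ Suc n)"
        then have "A v \<in> null_space (A ^^ n)" by (simp add: null_space_def funpow_swap1)
        with Suc have "A v - shift A \<nu> v \<in> range (shift A \<nu>)"
          by (intro complex_vector.subspace_diff[OF subspace_range[OF B]]) auto
        \<comment> \<open>Dividing by \<open>\<nu>\<close> expresses \<open>v\<close> through
          \<open>A v\<close>, which lies one kernel lower, and a vector of the range.\<close>
        moreover have "A v - shift A \<nu> v = \<nu> *\<^sub>C v" by (simp add: shift_def)
        ultimately have "\<nu> *\<^sub>C v \<in> range (shift A \<nu>)" by simp
        then have "inverse \<nu> *\<^sub>C (\<nu> *\<^sub>C v) \<in> range (shift A \<nu>)"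
          by (rule complex_vector.subspace_scale[OF subspace_range[OF B]])
        then show "v \<in> range (shift A \<nu>)" using \<nu>(1) by (simp add: scaleC_scaleC)
      qed
    qed
    have "x \<in> range (shift A \<nu>)" for x
    proof -
      obtain k where "k \<in> null_space (A ^^ p)" "x - k \<in> range (A ^^ p)" using dec(2) by blast
      with Mr Kr[of p] have "k + (x - k) \<in> range (shift A \<nu>)"
        by (intro complex_vector.subspace_add[OF subspace_range[OF B]]) auto
      then show ?thesis by simp
    qed
    with inj show "bij (shift A \<nu>)" by (auto simp: bij_def)
  qed (use c in simp)
qed

text \<open>A single bijective \<open>A - \<nu>\<close> suffices: it commutes with A^p, so it maps
  R(A^p) onto itself, and perturbing back to 0 gives the same for \<open>A\<close>. Then A^p x = A^p
  (A z) for some z, which splits x into x - A z in the kernel of A^p and A z in the range.\<close>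

lemma punctured_bij_imp_weyl:
  fixes A :: "'a::complex_banach \<Rightarrow> 'a"
  assumes A: "bounded_clinear A" and S: "SVEP A"
    and cl: "closed (range A)" and N: "fin_dim (null_space A)"
    and e: "e > 0" "\<And>\<nu>. \<nu> \<noteq> 0 \<Longrightarrow> norm \<nu> < e \<Longrightarrow> bij (shift A \<nu>)"
  shows "weyl A"
proof -
  note A_simps = bounded_clinear_simps[OF A]
  obtain p c where c: "c > 0" "\<And>x. x \<in> range (A ^^ p) \<Longrightarrow> c * norm x \<le> norm (A x)"
    "weyl A \<longleftrightarrow> (\<forall>x. \<exists>k\<in>null_space (A ^^ p). x - k \<in> range A)"
    by (rule SVEP_bounded_below_on_range[OF A S cl N]) blast
  let ?M = "range (A ^^ p)"
  have M: "closed ?M" "complex_vector.subspace ?M"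
    by (rule closed_range_funpow[OF A cl N], rule subspace_range[OF bounded_clinear_funpow[OF A]])
  \<comment> \<open>The bound \<open>e / 2\<close> keeps \<open>\<nu>\<close> in the punctured disc
    of bijectivity. With modulus at most \<open>c / 4\<close>, the shifted operator retains the
    lower bound \<open>c / 2\<close> on \<open>?M\<close>, and \<open>c / 4\<close> is half of that,
    the distance allowed for the return to 0.\<close>
  define \<nu> where "\<nu> = complex_of_real (min (e / 2) (c / 4))"
  have \<nu>: "\<nu> \<noteq> 0" "norm \<nu> < e" "norm \<nu> \<le> c / 4" using e(1) c(1) by (auto simp: \<nu>_def)
  have "?M \<subseteq> shift A \<nu> ` ?M"
  proof
    fix y assume "y \<in> ?M"
    then obtain u where u: "y = (A ^^ p) u" by blast
    obtain v where "u = shift A \<nu> v" using e(2)[OF \<nu>(1,2)] by (metis bij_is_surj surjD)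
    then have "y = shift A \<nu> ((A ^^ p) v)" using u by (simp add: shift_funpow_commute[OF A])
    then show "y \<in> shift A \<nu> ` ?M" by blast
  qed
  then have onto: "shift A \<nu> ` ?M = ?M" using shift_range_funpow_subset[OF A] by blast
  have "shift A 0 ` ?M = ?M"
  proof (rule shift_onto_invariant[OF A M shift_range_funpow_subset[OF A] onto, where c = "c / 2"])
    fix x assume "x \<in> ?M"
    then have "c * norm x \<le> norm (A x)" by (rule c(2))
    also have "\<dots> \<le> norm (shift A \<nu> x) + norm \<nu> * norm x"
      using norm_triangle_ineq[of "shift A \<nu> x" "\<nu> *\<^sub>C x"] by (simp add: shift_def norm_scaleC)
    also have "norm \<nu> * norm x \<le> c / 4 * norm x" using \<nu>(3) by (rule mult_right_mono) simp
    finally have "c * norm x \<le> norm (shift A \<nu> x) + c / 4 * norm x" by simp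
    moreover have "0 \<le> c * norm x" using c(1) by simp
    ultimately show "c / 2 * norm x \<le> norm (shift A \<nu> x)" by simp
  qed (use c(1) \<nu>(3) in auto)
  then have AM: "A ` ?M = ?M" by simp
  have "\<exists>k\<in>null_space (A ^^ p). x - k \<in> range A" for x
  proof -
    have "(A ^^ p) x \<in> A ` ?M" using AM by simp
    then obtain z where z: "(A ^^ p) x = (A ^^ p) (A z)" by (auto simp: funpow_swap1)
    have "x - A z \<in> null_space (A ^^ p)"
      using z bounded_clinear_simps[OF bounded_clinear_funpow[OF A]] by (simp add: null_space_def)
    then show ?thesis by (intro bexI[of _ "x - A z"]) auto
  qed
  with c(3) show ?thesis by blast
qed

section \<open>Glocal spectral subspaces\<close>

lemma shift_change: "shift T w x = shift T z x - (w - z) *\<^sub>C x"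
  by (simp add: shift_def complex_vector.scale_left_diff_distrib)

text \<open>The first-order remainder \<open>e\<close> of a local resolvent satisfies
  \<open>(T - w) e = (w - z)^2 D\<close>, a form of the resolvent identity, so a lower bound for
  \<open>T - w\<close> on \<open>M\<close> makes it quadratically small.\<close>

lemma local_resolvent_differentiable:
  assumes T: "bounded_clinear T" and M: "complex_vector.subspace M"
    and c: "c > 0" "\<delta> > 0" "\<And>w m. dist w z < \<delta> \<Longrightarrow> m \<in> M \<Longrightarrow> c * norm m \<le> norm (shift T w m)"
    and h: "\<And>w. dist w z < \<delta> \<Longrightarrow> h w \<in> M \<and> shift T w (h w) = x"
    and D: "D \<in> M" "shift T z D = h z"
  shows "(h has_derivative (\<lambda>t. t *\<^sub>C D)) (at z)"
proof (rule has_derivative_quadratic_remainder[OF c(2)])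
  fix w assume w: "dist w z < \<delta>"
  have z: "h z \<in> M" "shift T z (h z) = x" using h[of z] c(2) by auto
  define e where "e = h w - h z - (w - z) *\<^sub>C D"
  have "e \<in> M" unfolding e_def using h[OF w] z(1) D(1)
    by (intro complex_vector.subspace_diff[OF M] complex_vector.subspace_scale[OF M]) auto
  then have "c * norm e \<le> norm (shift T w e)" by (rule c(3)[OF w])
  also have "shift T w e = shift T w (h w) - shift T w (h z) - (w - z) *\<^sub>C shift T w D"
    unfolding e_def by (simp add: bounded_clinear_simps[OF bounded_clinear_shift[OF T]])
  also have "\<dots> = (w - z) *\<^sub>C (w - z) *\<^sub>C D"
    using h[OF w] z(2) D(2)
    by (simp add: shift_change[of T w _ z] complex_vector.scale_right_diff_distrib)
  finally have "c * norm e \<le> norm D * (norm (w - z))\<^sup>2"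
    by (simp add: norm_scaleC norm_mult power2_eq_square mult_ac)
  then show "norm (h w - h z - (w - z) *\<^sub>C D) \<le> norm D / c * (norm (w - z))\<^sup>2"
    using c(1) by (simp add: e_def field_simps)
qed

lemma vanalytic_add: "f vanalytic_on U \<Longrightarrow> g vanalytic_on U \<Longrightarrow> (\<lambda>z. f z + g z) vanalytic_on U"
  unfolding vanalytic_on_def
proof
  fix z assume fg: "\<forall>z\<in>U. \<exists>D. (f has_derivative (\<lambda>h. h *\<^sub>C D)) (at z)"
    "\<forall>z\<in>U. \<exists>D. (g has_derivative (\<lambda>h. h *\<^sub>C D)) (at z)" and "z \<in> U"
  then obtain D E where "(f has_derivative (\<lambda>h. h *\<^sub>C D)) (at z)" "(g has_derivative (\<lambda>h. h *\<^sub>C E)) (at z)"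
    by blast
  from has_derivative_add[OF this] show "\<exists>D. ((\<lambda>z. f z + g z) has_derivative (\<lambda>h. h *\<^sub>C D)) (at z)"
    by (intro exI[of _ "D + E"]) (simp add: scaleC_add_right)
qed

lemma vanalytic_bounded_clinear:
  assumes f: "f vanalytic_on U" and P: "bounded_clinear P"
  shows "(\<lambda>z. P (f z)) vanalytic_on U"
  unfolding vanalytic_on_def
proof
  fix z assume "z \<in> U"
  then obtain D where "(f has_derivative (\<lambda>h. h *\<^sub>C D)) (at z)" using f by (auto simp: vanalytic_on_def)
  from bounded_linear.has_derivative[OF bounded_clinear_bounded_linear[OF P] this]
  show "\<exists>D. ((\<lambda>z. P (f z)) has_derivative (\<lambda>h. h *\<^sub>C D)) (at z)"
    by (intro exI[of _ "P D"]) (simp add: bounded_clinear_simps[OF P])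
qed

lemma bounded_clinear_scaleC: "bounded_clinear (\<lambda>x. c *\<^sub>C x)"
  by (simp add: bounded_clinear_def bounded_linear_scaleC_right scaleC_scaleC mult.commute)

lemma subspace_glocal_subspace:
  assumes T: "bounded_clinear T"
  shows "complex_vector.subspace (glocal_subspace T G)"
proof (rule complex_vector.subspaceI)
  note simps = bounded_clinear_simps[OF bounded_clinear_shift[OF T]]
  have "(\<lambda>_. 0) vanalytic_on - G"
    unfolding vanalytic_on_def by (auto intro!: exI[of _ 0])
  then show "0 \<in> glocal_subspace T G"
    unfolding glocal_subspace_def using simps by (intro CollectI exI[of _ "\<lambda>_. 0"]) auto
  fix x y assume "x \<in> glocal_subspace T G" "y \<in> glocal_subspace T G"
  then obtain f g where "f vanalytic_on - G" "\<forall>\<mu>\<in>- G. shift T \<mu> (f \<mu>) = x"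
    "g vanalytic_on - G" "\<forall>\<mu>\<in>- G. shift T \<mu> (g \<mu>) = y"
    unfolding glocal_subspace_def by blast
  then show "x + y \<in> glocal_subspace T G" unfolding glocal_subspace_def
    using vanalytic_add[of f "- G" g] simps by (intro CollectI exI[of _ "\<lambda>z. f z + g z"]) auto
next
  note simps = bounded_clinear_simps[OF bounded_clinear_shift[OF T]]
  fix c x assume "x \<in> glocal_subspace T G"
  then obtain f where "f vanalytic_on - G" "\<forall>\<mu>\<in>- G. shift T \<mu> (f \<mu>) = x"
    unfolding glocal_subspace_def by blast
  then show "c *\<^sub>C x \<in> glocal_subspace T G" unfolding glocal_subspace_def
    using vanalytic_bounded_clinear[OF _ bounded_clinear_scaleC, of f "- G" c] simps
    by (intro CollectI exI[of _ "\<lambda>z. c *\<^sub>C f z"]) auto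
qed

text \<open>The local resolvent of \<open>A\<^sup>p x\<close> stays in the range of \<open>A\<^sup>p\<close>, where \<open>A - \<nu>\<close> is invertible
  for all small \<open>\<nu>\<close>; so it extends analytically over \<open>\<lambda>\<close> and Liouville's theorem applies.\<close>

lemma glocal_subset_null_space_funpow:
  fixes T :: "'a::complex_banach \<Rightarrow> 'a"
  assumes T: "bounded_clinear T" and A_def: "A = shift T l"
    and c: "c > 0" "\<And>m. m \<in> range (A ^^ p) \<Longrightarrow> c * norm m \<le> norm (A m)"
    and AM: "A ` range (A ^^ p) = range (A ^^ p)"
  shows "glocal_subspace T {l} \<subseteq> null_space (A ^^ p)"
proof
  fix x assume "x \<in> glocal_subspace T {l}"
  then obtain f where f: "f vanalytic_on - {l}" "\<And>\<mu>. \<mu> \<noteq> l \<Longrightarrow> shift T \<mu> (f \<mu>) = x"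
    unfolding glocal_subspace_def by auto
  have A: "bounded_clinear A" unfolding A_def by (rule bounded_clinear_shift[OF T])
  note P = bounded_clinear_funpow[OF A, of p]
  have TA: "shift T \<mu> = shift A (\<mu> - l)" for \<mu> by (simp add: A_def shift_shift)
  let ?M = "range (A ^^ p)"
  have subM: "complex_vector.subspace ?M" by (rule subspace_range[OF P])
  define x' where "x' = (A ^^ p) x"
  have "x' \<in> A ` ?M" unfolding AM by (simp add: x'_def)
  then obtain m0 where m0: "m0 \<in> ?M" "A m0 = x'" by blast
  then have "m0 \<in> A ` ?M" unfolding AM by simp
  \<comment> \<open>Using that \<open>A\<close> maps \<open>?M\<close> onto itself twice yields the
    value \<open>m0\<close> filled in at \<open>l\<close> and the derivative \<open>D\<close> of the
    extended function there.\<close>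
  then obtain D where D: "D \<in> ?M" "A D = m0" by blast
  define g where "g \<mu> = (if \<mu> = l then m0 else (A ^^ p) (f \<mu>))" for \<mu>
  have gM: "g \<mu> \<in> ?M" and gx: "shift T \<mu> (g \<mu>) = x'" for \<mu>
  proof -
    show "g \<mu> \<in> ?M" using m0 by (simp add: g_def)
    show "shift T \<mu> (g \<mu>) = x'"
    proof (cases "\<mu> = l")
      case False
      then have "shift T \<mu> (g \<mu>) = (A ^^ p) (shift T \<mu> (f \<mu>))"
        unfolding TA by (simp add: g_def shift_funpow_commute[OF A])
      then show ?thesis by (simp add: f(2)[OF False] x'_def)
    qed (simp add: g_def m0 flip: A_def)
  qed
  have "g vanalytic_on UNIV" unfolding vanalytic_on_def
  proof
    fix z
    show "\<exists>D. (g has_derivative (\<lambda>h. h *\<^sub>C D)) (at z)"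
    proof (cases "z = l")
      case True
      have "(g has_derivative (\<lambda>t. t *\<^sub>C D)) (at z)"
      proof (rule local_resolvent_differentiable[OF T subM])
        show "c / 2 > 0" "c / 2 > 0" using c(1) by auto
        show "shift T z D = g z" using D(2) by (simp add: True g_def flip: A_def)
        fix w m assume w: "dist w z < c / 2" and m: "m \<in> ?M"
        have "c * norm m \<le> norm (A m)" by (rule c(2)[OF m])
        also have "A m = shift T w m + (w - z) *\<^sub>C m" by (simp add: shift_change[of T w m z] True A_def)
        also have "norm \<dots> \<le> norm (shift T w m) + norm (w - z) * norm m"
          using norm_triangle_ineq[of "shift T w m" "(w - z) *\<^sub>C m"] by (simp add: norm_scaleC)
        also have "norm (w - z) * norm m \<le> c / 2 * norm m"
          using w by (intro mult_right_mono) (auto simp: dist_norm)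
        finally show "c / 2 * norm m \<le> norm (shift T w m)" by simp
      qed (use D gM gx in auto)
      then show ?thesis by blast
    next
      case False
      then obtain D where D: "((\<lambda>\<mu>. (A ^^ p) (f \<mu>)) has_derivative (\<lambda>h. h *\<^sub>C D)) (at z)"
        using vanalytic_bounded_clinear[OF f(1) P] by (auto simp: vanalytic_on_def)
      have "(g has_derivative (\<lambda>h. h *\<^sub>C D)) (at z)"
        by (rule has_derivative_transform_within_open[OF D, of "- {l}"]) (use False in \<open>auto simp: g_def\<close>)
      then show ?thesis by blast
    qed
  qed
  moreover have "(g \<longlongrightarrow> 0) at_infinity"
  proof -
    obtain K where K: "\<And>v. norm (T v) \<le> norm v * K"
      using bounded_linear.bounded[OF bounded_clinear_bounded_linear[OF T]] by blast
    show ?thesis unfolding Lim_at_infinity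
    proof (intro allI impI)
      fix e :: real assume e: "e > 0"
      \<comment> \<open>The equation for \<open>g\<close> gives
        \<open>norm (g \<mu>) * (norm \<mu> - K) \<le> norm x'\<close>. Beyond this radius a value
        of norm at least \<open>e\<close> would make the left side at least
        \<open>norm x' + e\<close>.\<close>
      have "dist (g \<mu>) 0 < e" if \<mu>: "norm \<mu> \<ge> K + norm x' / e + 1" for \<mu>
      proof (rule ccontr)
        assume "\<not> dist (g \<mu>) 0 < e"
        then have ge: "e \<le> norm (g \<mu>)" by simp
        have "norm (\<mu> *\<^sub>C g \<mu>) \<le> norm (T (g \<mu>)) + norm (shift T \<mu> (g \<mu>))"
          using norm_triangle_ineq4[of "T (g \<mu>)" "shift T \<mu> (g \<mu>)"] by (simp add: shift_def)
        with K[of "g \<mu>"] have "norm \<mu> * norm (g \<mu>) \<le> norm (g \<mu>) * K + norm x'"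
          by (simp add: norm_scaleC gx)
        then have 1: "norm (g \<mu>) * (norm \<mu> - K) \<le> norm x'" by (simp add: algebra_simps)
        have "e * (norm x' / e + 1) \<le> norm (g \<mu>) * (norm \<mu> - K)"
          using ge \<mu> e by (intro mult_mono) auto
        with 1 have "e * (norm x' / e + 1) \<le> norm x'" by linarith
        with e show False by (simp add: algebra_simps)
      qed
      then show "\<exists>B. \<forall>\<mu>. B \<le> norm \<mu> \<longrightarrow> dist (g \<mu>) 0 < e" by blast
    qed
  qed
  ultimately have "g l = 0" by (rule vanalytic_Liouville)
  then have "x' = 0" using gx[of l] bounded_clinear_simps(4)[OF bounded_clinear_shift[OF T]] by simp
  then show "x \<in> null_space (A ^^ p)" by (simp add: null_space_def x'_def)
qed

section \<open>Resolvents, contour integrals and the Riesz projection\<close>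

lemma bounded_bilinear_scaleC:
  "bounded_bilinear (scaleC :: complex \<Rightarrow> 'a \<Rightarrow> 'a::complex_normed_vector)"
proof
  show "\<exists>K. \<forall>c (x::'a). norm (c *\<^sub>C x) \<le> norm c * norm x * K"
    by (intro exI[of _ 1]) (simp add: norm_scaleC)
qed (simp_all add: scaleC_add_left scaleC_add_right
    linear_simps(5)[OF bounded_linear_scaleC_left] linear_simps(5)[OF bounded_linear_scaleC_right])

lemmas continuous_on_scaleC = bounded_bilinear.continuous_on[OF bounded_bilinear_scaleC]

lemma resolvent_vanalytic:
  fixes T :: "'a::complex_banach \<Rightarrow> 'a"
  assumes T: "bounded_clinear T" and U: "open U" "\<And>\<mu>. \<mu> \<in> U \<Longrightarrow> bij (shift T \<mu>)"
  shows "(\<lambda>\<mu>. inv (shift T \<mu>) x) vanalytic_on U"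
  unfolding vanalytic_on_def
proof
  fix z assume z: "z \<in> U"
  have inv: "shift T \<mu> (inv (shift T \<mu>) y) = y" if "\<mu> \<in> U" for \<mu> y
    using U(2)[OF that] by (simp add: bij_is_surj surj_f_inv_f)
  obtain d where d: "d > 0" "\<And>w. dist w z < d \<Longrightarrow> w \<in> U" using U(1) z by (auto simp: open_dist)
  have surj: "range (shift T z) = UNIV" using U(2)[OF z] by (rule bij_is_surj)
  obtain C where C: "C > 0"
    "\<And>y. y \<in> range (shift T z) \<Longrightarrow> \<exists>x\<in>UNIV. shift T z x = y \<and> norm x \<le> C * norm y"
    by (rule open_mapping_bound[OF bounded_clinear_bounded_linear[OF bounded_clinear_shift[OF T]]
          closed_UNIV subspace_UNIV, of z]) (simp_all add: surj)
  have low: "norm m \<le> C * norm (shift T z m)" for m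
    using C(2)[of "shift T z m"] bij_is_inj[OF U(2)[OF z]] by (auto dest: injD)
  have "((\<lambda>\<mu>. inv (shift T \<mu>) x) has_derivative
      (\<lambda>t. t *\<^sub>C inv (shift T z) (inv (shift T z) x))) (at z)"
  proof (rule local_resolvent_differentiable[OF T complex_vector.subspace_UNIV])
    \<comment> \<open>\<open>T - z\<close> has lower bound \<open>1 / C\<close>, and a move of the
      parameter by less than \<open>1 / (2 * C)\<close> costs at most half of it.\<close>
    show "1 / (2 * C) > 0" "min d (1 / (2 * C)) > 0" using C(1) d(1) by auto
    show "shift T z (inv (shift T z) (inv (shift T z) x)) = inv (shift T z) x" by (rule inv[OF z])
    fix w m assume w: "dist w z < min d (1 / (2 * C))"
    show "inv (shift T w) x \<in> UNIV \<and> shift T w (inv (shift T w) x) = x" using inv d(2) w by simp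
    have "norm m \<le> C * norm (shift T z m)" by (rule low)
    also have "shift T z m = shift T w m + (w - z) *\<^sub>C m" by (simp add: shift_change[of T w m z])
    also have "norm \<dots> \<le> norm (shift T w m) + norm (w - z) * norm m"
      using norm_triangle_ineq[of "shift T w m" "(w - z) *\<^sub>C m"] by (simp add: norm_scaleC)
    also have "norm (w - z) * norm m \<le> 1 / (2 * C) * norm m"
      using w by (intro mult_right_mono) (auto simp: dist_norm)
    finally show "1 / (2 * C) * norm m \<le> norm (shift T w m)"
      using C(1) by (simp add: field_simps)
  qed simp
  then show "\<exists>D. ((\<lambda>\<mu>. inv (shift T \<mu>) x) has_derivative (\<lambda>t. t *\<^sub>C D)) (at z)" by blast
qed

lemma vanalytic_imp_continuous_on: "f vanalytic_on U \<Longrightarrow> continuous_on U f"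
  unfolding vanalytic_on_def
  by (intro continuous_at_imp_continuous_on) (auto dest: has_derivative_continuous)

text \<open>The circle satisfies d\<mu>/dt = 2 \<pi> i (\<mu> - l), so the integrand is the Cauchy
  kernel with its normalising factor, written in the real parameter. Its integral vanishes because
  \<open>w\<close> lies outside the circle.\<close>

lemma circlepath_Cauchy_kernel_outside:
  assumes r: "r > 0" and w: "r < dist w l"
  shows "((\<lambda>t. (circlepath l r t - l) / (circlepath l r t - w)) has_integral 0) {0..1}"
proof -
  have "((\<lambda>z. 1 / (z - w)) has_contour_integral 0) (circlepath l r)"
  proof (rule Cauchy_theorem_convex_simple)
    show "(\<lambda>z. 1 / (z - w)) holomorphic_on ball l (dist w l)"
      by (intro holomorphic_intros) (auto simp: dist_commute)
    show "path_image (circlepath l r) \<subseteq> ball l (dist w l)" using r w by auto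
  qed auto
  then have "((\<lambda>t. 1 / (circlepath l r t - w) *
      vector_derivative (circlepath l r) (at t within {0..1})) has_integral 0) {0..1}"
    by (simp add: has_contour_integral_def)
  from has_integral_mult_right[OF this, of "1 / (2 * pi * \<i>)"]
  have "((\<lambda>t. 1 / (2 * pi * \<i>) * (1 / (circlepath l r t - w) *
      vector_derivative (circlepath l r) (at t within {0..1}))) has_integral 0) {0..1}"
    by (simp only: mult_zero_right)
  then show ?thesis
    by (rule has_integral_eq[rotated]) (simp add: vector_derivative_circlepath01, simp add: circlepath)
qed

text \<open>Up to sign, \<open>u = \<integral>(\<mu> - l) (T - \<mu>)\<^sup>-\<^sup>1 x\<close> below is the Riesz projection of \<open>x\<close> onto the
  spectral subspace of the isolated point \<open>l\<close>; the Cauchy transform of the local resolvent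
  witnesses that it lies in the glocal subspace.\<close>

lemma glocal_plus_range:
  fixes T :: "'a::complex_banach \<Rightarrow> 'a"
  assumes T: "bounded_clinear T" and e: "e > 0"
    and bij: "\<And>\<mu>. \<mu> \<noteq> l \<Longrightarrow> dist \<mu> l < e \<Longrightarrow> bij (shift T \<mu>)"
  shows "\<exists>k\<in>glocal_subspace T {l}. x - k \<in> range (shift T l)"
proof -
  define r where "r = e / 2"
  have r: "0 < r" "r < e" using e by (auto simp: r_def)
  define U where "U = ball l e - {l}"
  have U: "open U" "\<And>\<mu>. \<mu> \<in> U \<Longrightarrow> bij (shift T \<mu>)"
    unfolding U_def using bij by (auto simp: dist_commute)
  define \<mu> where "\<mu> = circlepath l r"
  have \<mu>: "cmod (\<mu> t - l) = r" for t using r by (simp add: \<mu>_def circlepath norm_mult)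
  have \<mu>U: "\<mu> t \<in> U" for t using \<mu>[of t] r by (auto simp: U_def dist_norm norm_minus_commute)
  define \<rho> where "\<rho> t = inv (shift T (\<mu> t)) x" for t
  have \<rho>: "shift T (\<mu> t) (\<rho> t) = x" for t
    unfolding \<rho>_def using U(2)[OF \<mu>U] by (simp add: bij_is_surj surj_f_inv_f)
  have T\<rho>: "shift T w (\<rho> t) = x + (\<mu> t - w) *\<^sub>C \<rho> t" for w t
    using \<rho>[of t] by (simp add: shift_change[of T w _ "\<mu> t"] complex_vector.scale_left_diff_distrib)
  have cont_\<mu>: "continuous_on {0..1} \<mu>"
    unfolding \<mu>_def using path_circlepath by (simp add: path_def)
  have cont_\<rho>: "continuous_on {0..1} \<rho>"
    unfolding \<rho>_def
    by (rule continuous_on_compose2[OF vanalytic_imp_continuous_on[OF resolvent_vanalytic[OF T U]] cont_\<mu>])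
      (use \<mu>U in auto)
  have cont: "continuous_on {0..1} (\<lambda>t. k t *\<^sub>C \<rho> t)" if "continuous_on {0..1} k" for k
    by (rule continuous_on_scaleC[OF that cont_\<rho>])
  \<comment> \<open>Since \<open>(T - w) \<rho> t = x + (\<mu> t - w) \<rho> t\<close>, the operator
    turns a weighted integral of \<open>\<rho>\<close> into a scalar multiple of \<open>x\<close>
    plus another weighted integral. The Cauchy weight makes the scalar vanish, and the weight 1 at
    \<open>w = l\<close> produces \<open>x + u\<close>.\<close>
  have shift_int: "shift T w (integral {0..1} (\<lambda>t. k t *\<^sub>C \<rho> t)) =
      integral {0..1} k *\<^sub>C x + integral {0..1} (\<lambda>t. (k t * (\<mu> t - w)) *\<^sub>C \<rho> t)"
    if k: "continuous_on {0..1} k" for k w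
  proof -
    note sT = bounded_clinear_shift[OF T, of w]
    have "shift T w (integral {0..1} (\<lambda>t. k t *\<^sub>C \<rho> t)) = integral {0..1} (\<lambda>t. shift T w (k t *\<^sub>C \<rho> t))"
      using integral_linear[OF integrable_continuous_interval[OF cont[OF k]] bounded_clinear_bounded_linear[OF sT]]
      by (simp add: comp_def)
    also have "\<dots> = integral {0..1} (\<lambda>t. k t *\<^sub>C x + (k t * (\<mu> t - w)) *\<^sub>C \<rho> t)"
      by (simp add: bounded_clinear_simps(5)[OF sT] T\<rho> scaleC_add_right scaleC_scaleC)
    also have "\<dots> = integral {0..1} (\<lambda>t. k t *\<^sub>C x) + integral {0..1} (\<lambda>t. (k t * (\<mu> t - w)) *\<^sub>C \<rho> t)"
      by (intro Henstock_Kurzweil_Integration.integral_add integrable_continuous_interval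
          cont continuous_on_scaleC continuous_intros k cont_\<mu>)
    also have "integral {0..1} (\<lambda>t. k t *\<^sub>C x) = integral {0..1} k *\<^sub>C x"
      using integral_linear[OF integrable_continuous_interval[OF k] bounded_linear_scaleC_left, of x]
      by (simp add: comp_def)
    finally show ?thesis .
  qed
  define u where "u = integral {0..1} (\<lambda>t. (\<mu> t - l) *\<^sub>C \<rho> t)"
  \<comment> \<open>For \<open>w\<close> outside the circle \<open>F w\<close> is a local resolvent
    of \<open>u\<close>: multiplying its weight by \<open>\<mu> t - w\<close> leaves the weight
    \<open>\<mu> t - l\<close> of \<open>u\<close>.\<close>
  define F where "F w = integral {0..1} (\<lambda>t. ((\<mu> t - l) / (\<mu> t - w)) *\<^sub>C \<rho> t)" for w
  have far: "cmod (\<mu> t - w) \<ge> dist w l - r" for t w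
    using norm_triangle_ineq2[of "w - l" "\<mu> t - l"] \<mu>[of t]
    by (simp add: dist_norm norm_minus_commute)
  have ne: "\<mu> t \<noteq> w" if "r < dist w l" for t w using far[of w t] that by auto
  have F: "shift T w (F w) = u" if w: "r < dist w l" for w
  proof -
    have k: "continuous_on {0..1} (\<lambda>t. (\<mu> t - l) / (\<mu> t - w))"
      using ne[OF w] by (intro continuous_intros cont_\<mu>) auto
    have "integral {0..1} (\<lambda>t. (\<mu> t - l) / (\<mu> t - w)) = 0"
      using circlepath_Cauchy_kernel_outside[OF r(1) w] unfolding \<mu>_def by (rule integral_unique)
    then show ?thesis using shift_int[OF k, of w] ne[OF w] by (simp add: F_def u_def)
  qed
  have F_diff: "\<exists>D. (F has_derivative (\<lambda>h. h *\<^sub>C D)) (at z)" if z: "r < dist z l" for z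
  proof -
    define d where "d = dist z l - r"
    have d: "d > 0" using z by (simp add: d_def)
    obtain B where B: "\<And>t. t \<in> {0..1} \<Longrightarrow> norm (\<rho> t) \<le> B"
      using compact_imp_bounded[OF compact_continuous_image[OF cont_\<rho> compact_Icc]]
      unfolding bounded_iff by blast
    define D where "D = integral {0..1} (\<lambda>t. ((\<mu> t - l) / (\<mu> t - z)\<^sup>2) *\<^sub>C \<rho> t)"
    have "(F has_derivative (\<lambda>h. h *\<^sub>C D)) (at z)"
    proof (rule has_derivative_quadratic_remainder)
      show "d / 2 > 0" using d by simp
      fix w assume w: "dist w z < d / 2"
      have wl: "dist w l - r \<ge> d / 2" using dist_triangle[of z l w] w by (simp add: d_def dist_commute)
      then have wr: "r < dist w l" using d by simp
      \<comment> \<open>The second-order remainder of the Cauchy weight, equal to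
        \<open>(\<mu> t - l) (w - z)^2 / ((\<mu> t - w) (\<mu> t - z)^2)\<close>. With
        \<open>\<mu> t - l\<close> of modulus \<open>r\<close> and the two distances at least
        \<open>d / 2\<close> and \<open>d\<close>, this produces the constant
        \<open>2 * r / d ^ 3\<close>.\<close>
      define k where "k t = (\<mu> t - l) / (\<mu> t - w) - (\<mu> t - l) / (\<mu> t - z) - (w - z) * ((\<mu> t - l) / (\<mu> t - z)\<^sup>2)" for t
      have int: "(\<lambda>t. ((\<mu> t - l) / (\<mu> t - w)) *\<^sub>C \<rho> t) integrable_on {0..1}"
        "(\<lambda>t. ((\<mu> t - l) / (\<mu> t - z)) *\<^sub>C \<rho> t) integrable_on {0..1}"
        "(\<lambda>t. ((\<mu> t - l) / (\<mu> t - z)\<^sup>2) *\<^sub>C \<rho> t) integrable_on {0..1}"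
        using ne[OF z] ne[OF wr]
        by (auto intro!: integrable_continuous_interval cont continuous_intros cont_\<mu>)
      have "(w - z) *\<^sub>C D = integral {0..1} (\<lambda>t. (w - z) *\<^sub>C ((\<mu> t - l) / (\<mu> t - z)\<^sup>2) *\<^sub>C \<rho> t)"
        unfolding D_def using integral_linear[OF int(3) bounded_linear_scaleC_right, of "w - z"]
        by (simp add: comp_def)
      moreover have "(\<lambda>t. (w - z) *\<^sub>C ((\<mu> t - l) / (\<mu> t - z)\<^sup>2) *\<^sub>C \<rho> t) integrable_on {0..1}"
        using integrable_linear[OF int(3) bounded_linear_scaleC_right, of "w - z"] by (simp add: comp_def)
      ultimately have "F w - F z - (w - z) *\<^sub>C D = integral {0..1} (\<lambda>t. k t *\<^sub>C \<rho> t)"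
        unfolding F_def using int
        by (simp add: k_def complex_vector.scale_left_diff_distrib scaleC_scaleC integrable_diff
            flip: Henstock_Kurzweil_Integration.integral_diff)
      also have "norm \<dots> \<le> (2 * r / d ^ 3 * B * (norm (w - z))\<^sup>2) * (1 - 0)"
      proof (rule integral_bound)
        show "continuous_on {0..1} (\<lambda>t. k t *\<^sub>C \<rho> t)" unfolding k_def
          using ne[OF z] ne[OF wr] by (intro cont continuous_intros cont_\<mu>) auto
        fix t :: real assume t: "t \<in> {0..1}"
        have "k t = (\<mu> t - l) * (w - z)\<^sup>2 / ((\<mu> t - w) * (\<mu> t - z)\<^sup>2)"
          using ne[OF z, of t] ne[OF wr, of t] unfolding k_def
          by (simp add: divide_simps power2_eq_square) (simp add: algebra_simps)
        then have "norm (k t) = r * (norm (w - z))\<^sup>2 / (cmod (\<mu> t - w) * (cmod (\<mu> t - z))\<^sup>2)"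
          by (simp add: norm_divide norm_mult norm_power \<mu>)
        also have "\<dots> \<le> r * (norm (w - z))\<^sup>2 / (d / 2 * d\<^sup>2)"
          using far[where t=t and w=w] far[where t=t and w=z] wl d r
          by (intro divide_left_mono mult_mono power_mono) (auto simp: d_def intro!: mult_pos_pos)
        also have "\<dots> = 2 * r / d ^ 3 * (norm (w - z))\<^sup>2" by (simp add: power3_eq_cube power2_eq_square mult_ac)
        finally have "norm (k t) * norm (\<rho> t) \<le> (2 * r / d ^ 3 * (norm (w - z))\<^sup>2) * B"
          using B[OF t] d r by (intro mult_mono) auto
        then show "norm (k t *\<^sub>C \<rho> t) \<le> 2 * r / d ^ 3 * B * (norm (w - z))\<^sup>2"
          by (simp add: norm_scaleC mult_ac)
      qed simp
      finally show "norm (F w - F z - (w - z) *\<^sub>C D) \<le> 2 * r / d ^ 3 * B * (norm (w - z))\<^sup>2" by simp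
    qed
    then show ?thesis by blast
  qed
  \<comment> \<open>The two formulas agree on the annulus between the radii \<open>r\<close> and
    \<open>e\<close>, where \<open>T - w\<close> is injective and both solve the equation with right
    side \<open>u\<close>. This overlap makes \<open>f\<close> analytic across the circle of radius
    \<open>e\<close>.\<close>
  define f where "f w = (if dist w l < e then inv (shift T w) u else F w)" for w
  have inv: "shift T w (inv (shift T w) y) = y" "inv (shift T w) (shift T w y) = y" if "w \<in> U" for w y
    using U(2)[OF that] by (simp_all add: bij_is_surj bij_is_inj surj_f_inv_f)
  have fF: "f w = F w" if "r < dist w l" for w
  proof (cases "dist w l < e")
    case True
    then have "w \<in> U" using that r by (auto simp: U_def dist_commute)
    from inv(2)[OF this, of "F w"] show ?thesis using True F[OF that] by (simp add: f_def)
  qed (simp add: f_def)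
  have "f vanalytic_on - {l}" unfolding vanalytic_on_def
  proof
    fix z assume z: "z \<in> - {l}"
    show "\<exists>D. (f has_derivative (\<lambda>h. h *\<^sub>C D)) (at z)"
    proof (cases "dist z l < e")
      case True
      then have zU: "z \<in> U" using z by (auto simp: U_def dist_commute)
      then obtain D where D: "((\<lambda>w. inv (shift T w) u) has_derivative (\<lambda>h. h *\<^sub>C D)) (at z)"
        using resolvent_vanalytic[OF T U] by (auto simp: vanalytic_on_def)
      have "(f has_derivative (\<lambda>h. h *\<^sub>C D)) (at z)"
        by (rule has_derivative_transform_within_open[OF D U(1) zU]) (auto simp: f_def U_def dist_commute)
      then show ?thesis by blast
    next
      case False
      then have zr: "r < dist z l" using r by simp
      then obtain D where D: "(F has_derivative (\<lambda>h. h *\<^sub>C D)) (at z)" using F_diff by blast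
      have "(f has_derivative (\<lambda>h. h *\<^sub>C D)) (at z)"
        by (rule has_derivative_transform_within_open[OF D, of "- cball l r"])
          (use zr in \<open>auto simp: fF dist_commute\<close>)
      then show ?thesis by blast
    qed
  qed
  moreover have "shift T w (f w) = u" if "w \<in> - {l}" for w
  proof (cases "dist w l < e")
    case True
    then have "w \<in> U" using that by (auto simp: U_def dist_commute)
    with True inv(1) show ?thesis by (simp add: f_def)
  next
    case False
    then show ?thesis using fF F r by simp
  qed
  ultimately have "u \<in> glocal_subspace T {l}" unfolding glocal_subspace_def by blast
  then have "- u \<in> glocal_subspace T {l}"
    by (rule complex_vector.subspace_neg[OF subspace_glocal_subspace[OF T]])
  moreover have "shift T l (integral {0..1} (\<lambda>t. 1 *\<^sub>C \<rho> t)) = x + u"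
    using shift_int[of "\<lambda>_. 1" l] by (simp add: u_def)
  then have "x - (- u) \<in> range (shift T l)" by (metis diff_minus_eq_add rangeI)
  ultimately show ?thesis by blast
qed

section \<open>Operator ranges of finite codimension\<close>

lemma fin_dim_complement:
  assumes K: "fin_dim K" and R: "complex_vector.subspace R" and sum: "\<forall>x. \<exists>k\<in>K. x - k \<in> R"
  obtains C where "quotient_basis R C"
proof -
  have subK: "complex_vector.subspace K" using K by (rule fin_dim_subspace)
  have subKR: "complex_vector.subspace (K \<inter> R)" by (rule complex_vector.subspace_inter[OF subK R])
  obtain B0 where B0: "finite B0" "complex_vector.independent B0" "B0 \<subseteq> K \<inter> R"
      "complex_vector.span B0 = K \<inter> R"
    by (rule fin_dim_basis[OF fin_dim_subset[OF K subKR]]) auto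
  have "B0 \<subseteq> K" using B0(3) by blast
  then obtain B where B: "B0 \<subseteq> B" "B \<subseteq> K" "complex_vector.independent B" "K \<subseteq> complex_vector.span B"
    using B0(2) by (rule complex_vector.maximal_independent_subset_extend)
  obtain BK where BK: "finite BK" "complex_vector.span BK = K" using K by (auto simp: fin_dim_def)
  have finB: "finite B" using complex_vector.independent_span_bound[OF BK(1) B(3)] B(2) BK(2) by auto
  define C where "C = B - B0"
  have BC: "B = C \<union> B0" "C \<inter> B0 = {}" "finite C" using B(1) finB by (auto simp: C_def)
  have spC: "complex_vector.span C \<subseteq> K"
    using B(2) by (intro complex_vector.span_minimal[OF _ subK]) (auto simp: C_def)
  have "complex_vector.span C \<inter> (K \<inter> R) = {0}"
    using independent_Un_span_Int[of C B0] B(3) BC B0(1,4) by simp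
  then have int: "complex_vector.span C \<inter> R \<subseteq> {0}" using spC by blast
  have "\<exists>w\<in>complex_vector.span C. x - w \<in> R" for x
  proof -
    obtain k where k: "k \<in> K" "x - k \<in> R" using sum by blast
    then have "k \<in> complex_vector.span (C \<union> B0)" using B(4) BC(1) by auto
    then obtain w v where wv: "w \<in> complex_vector.span C" "v \<in> K \<inter> R" "k = w + v"
      unfolding complex_vector.span_Un B0(4) by blast
    have "(x - k) + v \<in> R" using k(2) wv(2) by (intro complex_vector.subspace_add[OF R]) auto
    with wv show ?thesis by (intro bexI[of _ w]) auto
  qed
  then have "quotient_basis R C"
    using BC(3) int complex_vector.independent_mono[OF B(3)] by (simp add: quotient_basis_iff[OF R] C_def)
  then show thesis by (rule that)
qed

text \<open>Adding a finite dimensional complement makes the surjection \<open>G\<close>, to which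
  the open mapping bound applies. For \<open>y\<close> in the range of \<open>A\<close> the
  complement component of a solution lies in \<open>span B \<inter> range A\<close> and vanishes, so
  the bound is one for \<open>A\<close> itself.\<close>

lemma fin_codim_closed_range:
  fixes A :: "'a::complex_banach \<Rightarrow> 'a"
  assumes A: "bounded_clinear A" and K: "fin_dim K" and sum: "\<forall>x. \<exists>k\<in>K. x - k \<in> range A"
  shows "closed (range A)"
proof -
  note R = subspace_range[OF A]
  note bl = bounded_clinear_bounded_linear[OF A]
  obtain B where "quotient_basis (range A) B" by (rule fin_dim_complement[OF K R sum])
  then have B: "finite B" "complex_vector.span B \<inter> range A \<subseteq> {0}"
    "\<And>x. \<exists>w\<in>complex_vector.span B. x - w \<in> range A"
    unfolding quotient_basis_iff[OF R] by blast+
  define M where "M = (UNIV :: 'a set) \<times> complex_vector.span B"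
  define G where "G z = A (fst z) + snd z" for z :: "'a \<times> 'a"
  have "fin_dim (complex_vector.span B)" using B(1) by (auto simp: fin_dim_def)
  then have "closed M" unfolding M_def by (intro closed_Times fin_dim_imp_closed closed_UNIV)
  moreover have "subspace M" unfolding M_def
    by (intro subspace_Times csubspace_imp_subspace) auto
  moreover have "bounded_linear G" unfolding G_def
    by (intro bounded_linear_add bounded_linear_compose[OF bl] bounded_linear_fst bounded_linear_snd)
  moreover have "G ` M = UNIV"
  proof (intro equalityI subsetI)
    fix y :: 'a
    obtain w a where w: "w \<in> complex_vector.span B" "y - w = A a" using B(3) by blast
    then have "y = G (a, w)" by (simp add: G_def algebra_simps)
    with w(1) show "y \<in> G ` M" by (auto simp: M_def)
  qed simp
  ultimately obtain C where C: "C > 0" "\<And>y. \<exists>z\<in>M. G z = y \<and> norm z \<le> C * norm y"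
    using open_mapping_bound[of G M] by (metis UNIV_I closed_UNIV)
  have "\<exists>x\<in>UNIV. A x = y \<and> norm x \<le> C * norm y" if y: "y \<in> range A" for y
  proof -
    obtain a w where aw: "w \<in> complex_vector.span B" "A a + w = y" "norm (a, w) \<le> C * norm y"
      using C(2)[of y] by (auto simp: M_def G_def)
    have "y - A a \<in> range A" using y by (intro complex_vector.subspace_diff[OF R]) auto
    then have "w = 0" using aw(1,2) B(2) by (auto simp: algebra_simps)
    with aw(2,3) show ?thesis by (intro bexI[of _ a]) (auto simp: norm_Pair)
  qed
  then show ?thesis
    using C(1) by (intro solvable_bound_imp_closed_range[OF bl closed_UNIV subspace_UNIV, of C]) auto
qed

section \<open>Reduced minimum modulus\<close>

lemma closed_null_space:
  assumes "bounded_clinear A"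
  shows "closed (null_space A)"
  unfolding null_space_def
  by (rule closed_Collect_eq[OF bounded_linear.continuous_on[OF bounded_clinear_bounded_linear[OF assms]
        continuous_on_id] continuous_on_const])

lemma reduced_min_modulus_nonneg: "0 \<le> reduced_min_modulus T \<zeta>"
  unfolding reduced_min_modulus_def by (intro INF_greatest) (simp add: infdist_nonneg)

text \<open>A positive reduced minimum modulus amounts to a uniform bound on suitable preimages:
  these may be changed by kernel vectors, so their norms can be brought close to the distance from
  the kernel.\<close>

lemma closed_range_iff_reduced_min_modulus:
  fixes T :: "'a::complex_banach \<Rightarrow> 'a"
  assumes T: "bounded_clinear T"
  shows "closed (range (shift T \<mu>)) \<longleftrightarrow> reduced_min_modulus T \<mu> \<noteq> 0"
proof -
  define A where "A = shift T \<mu>"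
  have A: "bounded_clinear A" unfolding A_def by (rule bounded_clinear_shift[OF T])
  note bl = bounded_clinear_bounded_linear[OF A]
  let ?N = "null_space A"
  have N0: "?N \<noteq> {}" using complex_vector.subspace_0[OF subspace_null_space[OF A]] by blast
  show ?thesis unfolding A_def[symmetric]
  proof
    assume "closed (range A)"
    then obtain C where C: "C > 0" "\<And>y. y \<in> range A \<Longrightarrow> \<exists>x\<in>UNIV. A x = y \<and> norm x \<le> C * norm y"
      by (rule open_mapping_bound[OF bl closed_UNIV subspace_UNIV]) blast
    have "ereal (1 / C) \<le> ereal (norm (A x) / infdist x ?N)" if x: "x \<in> - ?N" for x
    proof -
      have pos: "infdist x ?N > 0"
        using infdist_pos_not_in_closed[OF closed_null_space[OF A] N0] x by simp
      obtain x' where x': "A x' = A x" "norm x' \<le> C * norm (A x)" using C(2)[of "A x"] by blast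
      then have "x - x' \<in> ?N" by (simp add: null_space_def bounded_clinear_simps[OF A])
      then have "infdist x ?N \<le> dist x (x - x')" by (rule infdist_le)
      with x'(2) have "infdist x ?N \<le> C * norm (A x)" by (simp add: dist_norm)
      then show ?thesis using pos C(1) by (simp add: field_simps)
    qed
    then have "ereal (1 / C) \<le> reduced_min_modulus T \<mu>"
      unfolding reduced_min_modulus_def A_def by (intro INF_greatest)
    moreover have "0 < ereal (1 / C)" using C(1) by simp
    ultimately show "reduced_min_modulus T \<mu> \<noteq> 0" by auto
  next
    assume "reduced_min_modulus T \<mu> \<noteq> 0"
    then have "0 < reduced_min_modulus T \<mu>"
      using reduced_min_modulus_nonneg[of T \<mu>] by (simp add: order_less_le)
    \<comment> \<open>A finite \<open>c\<close> below the modulus covers the value \<infinity> of a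
      zero operator as well.\<close>
    then obtain c where c: "c > 0" "ereal c < reduced_min_modulus T \<mu>"
      using ereal_dense2[of 0] by auto
    have "\<exists>x\<in>UNIV. A x = y \<and> norm x \<le> 2 / c * norm y" if "y \<in> range A" for y
    proof (cases "y = 0")
      case True
      then show ?thesis by (intro bexI[of _ 0]) (simp_all add: bounded_clinear_simps[OF A])
    next
      case False
      from that obtain x where x: "y = A x" by blast
      then have xN: "x \<in> - ?N" using False by (simp add: null_space_def)
      then have pos: "infdist x ?N > 0"
        using infdist_pos_not_in_closed[OF closed_null_space[OF A] N0] by simp
      have "ereal c < ereal (norm (A x) / infdist x ?N)"
        using xN unfolding A_def
        by (intro less_le_trans[OF c(2)]) (unfold reduced_min_modulus_def, rule INF_lower)
      then have "infdist x ?N < norm y / c" using pos c(1) x by (simp add: field_simps)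
      \<comment> \<open>The factor 2 leaves room for a kernel vector \<open>n\<close> that only
        nearly attains the distance.\<close>
      also have "\<dots> < 2 / c * norm y" using c(1) False by (simp add: field_simps)
      finally obtain n where n: "n \<in> ?N" "dist x n < 2 / c * norm y"
        unfolding infdist_notempty[OF N0] by (auto simp: cINF_less_iff[OF N0])
      then have "A (x - n) = y" by (simp add: null_space_def x bounded_clinear_simps[OF A])
      with n(2) show ?thesis by (intro bexI[of _ "x - n"]) (auto simp: dist_norm)
    qed
    then show "closed (range A)"
      using c(1) by (intro solvable_bound_imp_closed_range[OF bl closed_UNIV subspace_UNIV, of "2 / c"]) auto
  qed
qed

text \<open>An eigenvector \<open>v\<close> for \<open>\<mu>\<close> is the test vector: at nearby
  \<open>\<nu>\<close> the kernel is zero, so its distance to the kernel is \<open>norm v\<close>,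
  and its quotient is exactly \<open>norm (\<nu> - \<mu>)\<close>.\<close>

lemma reduced_min_modulus_tendsto_0:
  assumes T: "bounded_clinear T" and e: "e > 0"
    and bij: "\<And>\<nu>. \<nu> \<noteq> \<mu> \<Longrightarrow> dist \<nu> \<mu> < e \<Longrightarrow> bij (shift T \<nu>)"
    and v: "v \<in> null_space (shift T \<mu>)" "v \<noteq> 0"
  shows "(reduced_min_modulus T \<longlongrightarrow> 0) (at \<mu>)"
proof (rule tendsto_sandwich)
  show "\<forall>\<^sub>F \<nu> in at \<mu>. 0 \<le> reduced_min_modulus T \<nu>" by (simp add: reduced_min_modulus_nonneg)
  have "((\<lambda>\<nu>. norm (\<nu> - \<mu>)) \<longlongrightarrow> norm (\<mu> - \<mu>)) (at \<mu>)" by (intro tendsto_intros)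
  then show "((\<lambda>\<nu>. ereal (norm (\<nu> - \<mu>))) \<longlongrightarrow> 0) (at \<mu>)"
    by (simp add: zero_ereal_def)
  have "reduced_min_modulus T \<nu> \<le> ereal (norm (\<nu> - \<mu>))" if \<nu>: "\<nu> \<noteq> \<mu>" "dist \<nu> \<mu> < e" for \<nu>
  proof -
    note simps = bounded_clinear_simps[OF bounded_clinear_shift[OF T, of \<nu>]]
    have N: "null_space (shift T \<nu>) = {0}"
    proof (intro equalityI subsetI)
      fix y assume "y \<in> null_space (shift T \<nu>)"
      then have "shift T \<nu> y = shift T \<nu> 0" by (simp add: null_space_def simps(4))
      with bij_is_inj[OF bij[OF \<nu>]] show "y \<in> {0}" by (simp add: inj_eq)
    qed (simp add: null_space_def simps(4))
    have "shift T \<nu> v = - ((\<nu> - \<mu>) *\<^sub>C v)"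
      using v(1) by (simp add: shift_change[of T \<nu> v \<mu>] null_space_def)
    then have "norm (shift T \<nu> v) / infdist v (null_space (shift T \<nu>)) = norm (\<nu> - \<mu>)"
      using v(2) by (simp add: N norm_scaleC infdist_singleton)
    moreover have "reduced_min_modulus T \<nu> \<le>
        ereal (norm (shift T \<nu> v) / infdist v (null_space (shift T \<nu>)))"
      unfolding reduced_min_modulus_def by (rule INF_lower) (use v(2) N in simp)
    ultimately show ?thesis by simp
  qed
  then show "\<forall>\<^sub>F \<nu> in at \<mu>. reduced_min_modulus T \<nu> \<le> ereal (norm (\<nu> - \<mu>))"
    unfolding eventually_at using e by blast
qed simp

section \<open>Weyl's theorem\<close>

lemma nullity_finite_iff: "nullity A < \<infinity> \<longleftrightarrow> fin_dim (null_space A)"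
  by (simp add: nullity_def cdim_def)

lemma nullity_zero_iff:
  assumes "fin_dim (null_space A)"
  shows "nullity A = 0 \<longleftrightarrow> null_space A = {0}"
proof -
  obtain B where B: "finite B" "complex_vector.span B = null_space A" "complex_vector.independent B"
    "card B = complex_vector.dim (null_space A)"
    using fin_dim_basis[OF assms] by metis
  have "nullity A = enat (card B)" using assms B(4) by (simp add: nullity_def cdim_def)
  moreover have "card B = 0 \<longleftrightarrow> null_space A = {0}"
  proof
    assume "null_space A = {0}"
    then have "B \<subseteq> {0}" using B(2) complex_vector.span_superset by blast
    moreover have "0 \<notin> B" using B(3) complex_vector.dependent_zero by blast
    ultimately show "card B = 0" by (auto simp: subset_singleton_iff)
  next
    assume "card B = 0"
    then have "B = {}" using B(1) by simp
    then show "null_space A = {0}" using B(2) by simp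
  qed
  ultimately show ?thesis by (simp add: zero_enat_def)
qed

lemma pi00D:
  fixes T :: "'a::complex_banach \<Rightarrow> 'a"
  assumes T: "bounded_clinear T" and \<mu>: "\<mu> \<in> pi00 T"
  obtains e v where "e > 0" "\<And>\<nu>. \<nu> \<noteq> \<mu> \<Longrightarrow> dist \<nu> \<mu> < e \<Longrightarrow> bij (shift T \<nu>)"
    "fin_dim (null_space (shift T \<mu>))" "v \<in> null_space (shift T \<mu>)" "v \<noteq> 0"
proof -
  have iso: "\<mu> isolated_in op_spectrum T" and N: "fin_dim (null_space (shift T \<mu>))"
    and pos: "nullity (shift T \<mu>) \<noteq> 0"
    using \<mu> unfolding pi00_def nullity_finite_iff by auto
  obtain e where e: "e > 0" "\<And>\<nu>. \<nu> \<in> op_spectrum T \<Longrightarrow> dist \<mu> \<nu> < e \<Longrightarrow> \<nu> = \<mu>"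
    using isolated_inE_dist[OF iso] by metis
  have "0 \<in> null_space (shift T \<mu>)" using N complex_vector.subspace_0 fin_dim_subspace by blast
  then obtain v where v: "v \<in> null_space (shift T \<mu>)" "v \<noteq> 0"
    using pos nullity_zero_iff[OF N] by auto
  show thesis
  proof (rule that[OF e(1) _ N v])
    fix \<nu> assume "\<nu> \<noteq> \<mu>" "dist \<nu> \<mu> < e"
    then have "\<nu> \<notin> op_spectrum T" using e(2) by (auto simp: dist_commute)
    then show "bij (shift T \<nu>)" by (simp add: bij_shift_iff_notin_spectrum[OF T])
  qed
qed

lemma weyl_spectrum_point_in_pi00:
  fixes T :: "'a::complex_banach \<Rightarrow> 'a"
  assumes T: "bounded_clinear T" and S: "SVEP T"
    and \<mu>: "\<mu> \<in> op_spectrum T" and w: "weyl (shift T \<mu>)"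
  shows "\<mu> \<in> pi00 T"
proof -
  define A where "A = shift T \<mu>"
  have A: "bounded_clinear A" unfolding A_def by (rule bounded_clinear_shift[OF T])
  have wA: "weyl A" using w by (simp add: A_def)
  then have N: "fin_dim (null_space A)" and cl: "closed (range A)"
    unfolding weyl_def fredholm_def nullity_finite_iff by auto
  obtain e where e: "e > 0" "\<And>\<nu>. \<nu> \<noteq> 0 \<Longrightarrow> norm \<nu> < e \<Longrightarrow> bij (shift A \<nu>)"
    using weyl_imp_punctured_bij[OF A _ wA] SVEP_shift[OF S] unfolding A_def by metis
  have iso: "\<mu> isolated_in op_spectrum T"
  proof (rule isolated_inI[OF \<mu> open_ball])
    show "ball \<mu> e \<inter> op_spectrum T = {\<mu>}"
    proof (intro equalityI subsetI)
      fix \<nu> assume \<nu>: "\<nu> \<in> ball \<mu> e \<inter> op_spectrum T"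
      then have "\<not> bij (shift A (\<nu> - \<mu>))"
        using bij_shift_iff_notin_spectrum[OF T, of \<nu>] by (simp add: A_def shift_shift)
      then show "\<nu> \<in> {\<mu>}" using e(2)[of "\<nu> - \<mu>"] \<nu> by (auto simp: dist_norm norm_minus_commute)
    qed (use \<mu> e(1) in auto)
  qed
  have "nullity A \<noteq> 0"
  proof
    assume "nullity A = 0"
    then have N0: "null_space A = {0}" using nullity_zero_iff[OF N] by simp
    \<comment> \<open>The count with the zero subspace as \<open>K\<close>: an injective Weyl
      operator is onto, which would put \<open>\<mu>\<close> outside the spectrum.\<close>
    have "weyl A \<longleftrightarrow> (\<forall>x. \<exists>k\<in>{0}. x - k \<in> range A)"
      using N N0 bounded_clinear_simps(4)[OF A] by (intro weyl_iff_fin_dim_sum[OF A cl]) auto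
    then have "surj A" using wA by (simp add: surj_def image_iff)
    moreover have "inj A"
    proof (rule injI)
      fix x y assume "A x = A y"
      then have "x - y \<in> null_space A" by (simp add: null_space_def bounded_clinear_simps[OF A])
      with N0 show "x = y" by simp
    qed
    ultimately have "bij A" by (simp add: bij_def)
    with bij_shift_iff_notin_spectrum[OF T] \<mu> show False by (auto simp: A_def)
  qed
  then show ?thesis using iso N unfolding pi00_def nullity_finite_iff by (simp add: A_def)
qed

lemma pi00_closed_range_iff_weyl:
  fixes T :: "'a::complex_banach \<Rightarrow> 'a"
  assumes T: "bounded_clinear T" and S: "SVEP T" and \<mu>: "\<mu> \<in> pi00 T"
  shows "closed (range (shift T \<mu>)) \<longleftrightarrow> weyl (shift T \<mu>)"
proof
  assume cl: "closed (range (shift T \<mu>))"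
  obtain e v where e: "e > 0" "\<And>\<nu>. \<nu> \<noteq> \<mu> \<Longrightarrow> dist \<nu> \<mu> < e \<Longrightarrow> bij (shift T \<nu>)"
    and N: "fin_dim (null_space (shift T \<mu>))" and "v \<in> null_space (shift T \<mu>)" "v \<noteq> 0"
    by (rule pi00D[OF T \<mu>]) blast
  show "weyl (shift T \<mu>)"
  proof (rule punctured_bij_imp_weyl[OF bounded_clinear_shift[OF T] SVEP_shift[OF S] cl N e(1)])
    fix \<nu> :: complex assume "\<nu> \<noteq> 0" "norm \<nu> < e"
    then show "bij (shift (shift T \<mu>) \<nu>)" unfolding shift_shift by (intro e(2)) (auto simp: dist_norm)
  qed
qed (simp add: weyl_def fredholm_def)

text \<open>Closed range is first upgraded to Weyl, since this is what makes \<open>A\<close> map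
  R(A^p) onto itself, as the Liouville argument requires. Conversely, the glocal subspace is itself
  the finite dimensional \<open>K\<close> in the codimension criterion.\<close>

lemma pi00_closed_range_iff_glocal:
  fixes T :: "'a::complex_banach \<Rightarrow> 'a"
  assumes T: "bounded_clinear T" and S: "SVEP T" and \<mu>: "\<mu> \<in> pi00 T"
  shows "closed (range (shift T \<mu>)) \<longleftrightarrow> fin_dim (glocal_subspace T {\<mu>})"
proof
  define A where "A = shift T \<mu>"
  have A: "bounded_clinear A" unfolding A_def by (rule bounded_clinear_shift[OF T])
  obtain e v where e: "e > 0" "\<And>\<nu>. \<nu> \<noteq> \<mu> \<Longrightarrow> dist \<nu> \<mu> < e \<Longrightarrow> bij (shift T \<nu>)"
    and N: "fin_dim (null_space (shift T \<mu>))" and "v \<in> null_space (shift T \<mu>)" "v \<noteq> 0"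
    by (rule pi00D[OF T \<mu>]) blast
  {
    assume cl: "closed (range (shift T \<mu>))"
    then have w: "weyl A" using pi00_closed_range_iff_weyl[OF T S \<mu>] by (simp add: A_def)
    have SA: "SVEP A" unfolding A_def by (rule SVEP_shift[OF S])
    obtain p c where c: "c > 0" "\<And>x. x \<in> range (A ^^ p) \<Longrightarrow> c * norm x \<le> norm (A x)"
      "weyl A \<longleftrightarrow> (\<forall>x. \<exists>k\<in>null_space (A ^^ p). x - k \<in> range A)"
      by (rule SVEP_bounded_below_on_range[OF A SA]) (use cl N in \<open>auto simp: A_def\<close>)
    have "glocal_subspace T {\<mu>} \<subseteq> null_space (A ^^ p)"
    proof (rule glocal_subset_null_space_funpow[OF T A_def c(1)])
      show "A ` range (A ^^ p) = range (A ^^ p)"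
        by (rule kernel_range_sum_decomposition(1)[OF A c(3)[THEN iffD1, OF w]])
    qed (rule c(2))
    moreover have "fin_dim (null_space (A ^^ p))"
      using fin_dim_null_space_funpow[OF A] N by (simp add: A_def)
    ultimately show "fin_dim (glocal_subspace T {\<mu>})"
      using fin_dim_subset subspace_glocal_subspace[OF T] by metis
  }
  assume "fin_dim (glocal_subspace T {\<mu>})"
  then show "closed (range (shift T \<mu>))"
    using glocal_plus_range[OF T e]
    by (intro fin_codim_closed_range[OF bounded_clinear_shift[OF T]]) auto
qed

text \<open>The limit at \<open>\<mu>\<close> is 0 whether or not the range is closed, so continuity
  is decided by the value at \<open>\<mu>\<close> alone.\<close>

lemma pi00_closed_range_iff_discontinuous:
  fixes T :: "'a::complex_banach \<Rightarrow> 'a"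
  assumes T: "bounded_clinear T" and \<mu>: "\<mu> \<in> pi00 T"
  shows "closed (range (shift T \<mu>)) \<longleftrightarrow> \<not> isCont (reduced_min_modulus T) \<mu>"
proof -
  obtain e v where ev: "e > 0" "\<And>\<nu>. \<nu> \<noteq> \<mu> \<Longrightarrow> dist \<nu> \<mu> < e \<Longrightarrow> bij (shift T \<nu>)"
    "v \<in> null_space (shift T \<mu>)" "v \<noteq> 0"
    by (rule pi00D[OF T \<mu>]) blast
  have lim: "(reduced_min_modulus T \<longlongrightarrow> 0) (at \<mu>)"
    by (rule reduced_min_modulus_tendsto_0[OF T ev])
  have "isCont (reduced_min_modulus T) \<mu> \<longleftrightarrow> reduced_min_modulus T \<mu> = 0"
  proof
    assume "isCont (reduced_min_modulus T) \<mu>"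
    then show "reduced_min_modulus T \<mu> = 0"
      unfolding isCont_def using lim by (rule LIM_unique)
  qed (use lim in \<open>simp add: isCont_def\<close>)
  then show ?thesis by (simp add: closed_range_iff_reduced_min_modulus[OF T])
qed

theorem theorem2p2:
  fixes T :: "'a::complex_banach \<Rightarrow> 'a"
  assumes infinite_dim: "\<not> fin_dim (UNIV :: 'a set)"
    and T: "bounded_clinear T"
    and SVEP: "SVEP T"
  shows
    "(weyls_theorem_holds T \<longleftrightarrow> (\<forall>\<mu>\<in>pi00 T. closed (range (shift T \<mu>)))) \<and>
     ((\<forall>\<mu>\<in>pi00 T. closed (range (shift T \<mu>))) \<longleftrightarrow>
        (\<forall>\<mu>\<in>pi00 T. fin_dim (glocal_subspace T {\<mu>}))) \<and>
     ((\<forall>\<mu>\<in>pi00 T. fin_dim (glocal_subspace T {\<mu>})) \<longleftrightarrow>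
        (\<forall>\<mu>\<in>pi00 T. \<not> isCont (reduced_min_modulus T) \<mu>))"
proof -
  \<comment> \<open>Under SVEP this inclusion always holds, so Weyl's theorem reduces to the other
    one: every point of \<open>pi00 T\<close> is a Weyl point.\<close>
  have "op_spectrum T - weyl_spectrum T \<subseteq> pi00 T"
    using weyl_spectrum_point_in_pi00[OF T SVEP] by (auto simp: weyl_spectrum_def)
  moreover have "pi00 T \<subseteq> op_spectrum T" by (auto simp: pi00_def isolated_in_def)
  ultimately have "weyls_theorem_holds T \<longleftrightarrow> (\<forall>\<mu>\<in>pi00 T. weyl (shift T \<mu>))"
    unfolding weyls_theorem_holds_def weyl_spectrum_def by blast
  then show ?thesis
    using pi00_closed_range_iff_weyl[OF T SVEP] pi00_closed_range_iff_glocal[OF T SVEP]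
      pi00_closed_range_iff_discontinuous[OF T] by simp
qed

end
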